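(* Suppose the energy $E$ is sufficiently large. There is a homeomorphism $\phi:\Lambda\to\Sigma$ such that, if $\sigma:\Sigma\to\Sigma$ denotes the shift map, then $\phi\circ\tilde f=\sigma\circ\phi$ on $\Lambda$. Here $\tilde f$ is the coin billiard map on the cylinder, $\Lambda=\bigcap_{n=-\infty}^{\infty}\tilde f^{\,n}(\widetilde D)$ is the invariant set of $\tilde f$ in $\widetilde D=\widetilde D_L\cup\widetilde D_R$, and $\Sigma$ is the set of bi-infinite sequences of the six symbols $L_1,L_2,L_3,R_1,R_2,R_3$ such that each of $L_1,L_2,L_3$ can be immediately followed only by (and by any of) $R_1,L_2,R_3$, and each of $R_1,R_2,R_3$ can be immediately followed only by (and by any of) $L_1,R_2,L_3$.
   Context: Billiard. Fix $g>0$ and an energy $E$ (the coin has total mass $1$, length $2$ and moment of inertia $1$). A point moves in $\mathcal{Q}=\{(\theta,y)\in\mathbb{R}^2: y\ge|\sin\theta|\}$ with energy $E=\frac{\dot\theta^2}{2}+\frac{\dot y^2}{2}+gy$. Between collisions $\ddot\theta=0$, $\ddot y=-g$, and at boundary points with $\theta\notin\pi\mathbb{Z}$ its velocity is reflected by the mirror law (Euclidean reflection across the boundary $y=|\sin\theta|$). Collisions are recorded by their incoming data. $\mathcal{P}_d$ is the set of collisions whose incoming velocity points downward, with coordinates $(\theta,\dot\theta)$: the footpoint is $(\theta,|\sin\theta|)$ and the incoming velocity is $\left(\dot\theta,-\sqrt{2E-2g|\sin\theta|-\dot\theta^2}\right)$. Right after the collision, $$\dot\theta_+=\frac{1}{1+\cos^2\theta}\left(\dot\theta\sin^2\theta-2\sqrt{2E-2g|\sin\theta|-\dot\theta^2}\,\cos\theta\,\frac{\sin\theta}{|\sin\theta|}\right).$$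 The return map $f$ sends the data $(\theta,\dot\theta)$ of a collision to the data $(\theta_1,\dot\theta_1)$ of the next collision (footpoint angle and incoming angular velocity). Domain. Let $$D_L=\{(\theta,\dot\theta)\in\mathcal{P}_d:|\theta-\tfrac{\pi}{2}|\le\tfrac kE,\ |\dot\theta|\le\tfrac{\sqrt2k}{\sqrt E}\},\qquad D_R=\{(\theta,\dot\theta)\in\mathcal{P}_d:|\theta-\tfrac{3\pi}{2}|\le\tfrac kE,\ |\dot\theta|\le\tfrac{\sqrt2k}{\sqrt E}\},$$ where $k=k(E)$, bounded between two positive constants independent of $E$, is chosen so that for the corner point $a=(\theta^a,\dot\theta^a)=\left(\frac\pi2-\frac kE,\frac{\sqrt2k}{\sqrt E}\right)$ one has $$\frac2g\left(\dot\theta^a_+\sqrt{2E-2g|\sin\theta^a|-(\dot\theta^a_+)^2}\right)+\pi=0,$$ with $\dot\theta_+^a$ the post-collision angular velocity given by the formula above. Quotient. Identify $\theta\sim\theta+2\pi n$, $n\in\mathbb{Z}$; the objects induced on the resulting cylinder are denoted by tildes: $\tilde f$, $\widetilde D_L$, $\widetilde D_R$, and $\widetilde D=\widetilde D_L\cup\widetilde D_R$. The set $\Lambda=\bigcap_{n=-\infty}^{\infty}\tilde f^{\,n}(\widetilde D)=\lim_{N\to\infty}\bigcap_{n=-N}^{N}\tilde f^{\,n}(\widetilde D)$ is the set of points that stay in $\widetilde D$ under all forward and backward iterations of $\tilde f$. Sequences. $\Sigma$ carries the topology induced from the product topology on bi-infinite sequences of symbols (discrete alphabet), and the shift is $(\sigma(s))_i=s_{i+1}$.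 *)

theory Defs
  imports "HOL-Analysis.Analysis"
begin

section \<open>The billiard in the region above the graph of the absolute value of sine\<close>

text \<open>Positions and velocities are pairs: (angle, height) and their time derivatives.\<close>

definition billiard_table :: "(real \<times> real) set" where
  "billiard_table = {(\<theta>, y). y \<ge> \<bar>sin \<theta>\<bar>}"

definition boundary_point :: "real \<Rightarrow> real \<times> real" where
  "boundary_point \<theta> = (\<theta>, \<bar>sin \<theta>\<bar>)"

text \<open>Slope of the boundary and the normal pointing into the table; meaningful only
  when \<open>sin \<theta> \<noteq> 0\<close>.\<close>

definition boundary_slope :: "real \<Rightarrow> real" where
  "boundary_slope \<theta> = cos \<theta> * sgn (sin \<theta>)"

lemma boundary_slope_correct:
  assumes "sin \<theta> \<noteq> 0"
  shows "((\<lambda>x. \<bar>sin x\<bar>) has_real_derivative boundary_slope \<theta>) (at \<theta>)"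
proof (cases "sin \<theta> > 0")
  case True
  have "eventually (\<lambda>x. sin x > 0) (nhds \<theta>)"
    using True by (intro order_tendstoD(1)[of sin "sin \<theta>"]) (auto intro!: tendsto_intros filterlim_ident)
  then have "eventually (\<lambda>x. \<bar>sin x\<bar> = sin x) (nhds \<theta>)"
    by eventually_elim auto
  moreover have "(sin has_real_derivative boundary_slope \<theta>) (at \<theta>)"
    using True by (auto intro!: derivative_eq_intros simp: boundary_slope_def)
  ultimately show ?thesis
    by (subst DERIV_cong_ev[OF refl _ refl]) auto
next
  case False
  with assms have neg: "sin \<theta> < 0" by simp
  have "eventually (\<lambda>x. sin x < 0) (nhds \<theta>)"
    using neg by (intro order_tendstoD(2)[of sin "sin \<theta>"]) (auto intro!: tendsto_intros filterlim_ident)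
  then have "eventually (\<lambda>x. \<bar>sin x\<bar> = - sin x) (nhds \<theta>)"
    by eventually_elim auto
  moreover have "((\<lambda>x. - sin x) has_real_derivative boundary_slope \<theta>) (at \<theta>)"
    using neg by (auto intro!: derivative_eq_intros simp: boundary_slope_def)
  ultimately show ?thesis
    by (subst DERIV_cong_ev[OF refl _ refl]) auto
qed

definition inward_normal :: "real \<Rightarrow> real \<times> real" where
  "inward_normal \<theta> = (- boundary_slope \<theta>, 1)"

definition mirror :: "'a::real_inner \<Rightarrow> 'a \<Rightarrow> 'a" where
  "mirror n v = v - (2 * (v \<bullet> n) / (n \<bullet> n)) *\<^sub>R n"

text \<open>Free motion with \<open>\<theta>'' = 0\<close> and \<open>y'' = - g\<close>, from position \<open>p\<close> with
  velocity \<open>v\<close>.\<close>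

definition flight :: "real \<Rightarrow> real \<times> real \<Rightarrow> real \<times> real \<Rightarrow> real \<Rightarrow> real \<times> real" where
  "flight g p v t = (fst p + t * fst v, snd p + t * snd v - g * t\<^sup>2 / 2)"

definition flight_velocity :: "real \<Rightarrow> real \<times> real \<Rightarrow> real \<Rightarrow> real \<times> real" where
  "flight_velocity g v t = (fst v, snd v - g * t)"

lemma flight_solves_equations_of_motion:
  "flight g p v 0 = p" "flight_velocity g v 0 = v"
  "(flight g p v has_vector_derivative flight_velocity g v t) (at t)"
  "(flight_velocity g v has_vector_derivative (0, - g)) (at t)"
  by (auto simp: flight_def[abs_def] flight_velocity_def[abs_def]
      simp flip: has_real_derivative_iff_has_vector_derivative
      intro!: has_vector_derivative_Pair derivative_eq_intros)

definition energy :: "real \<Rightarrow> real \<times> real \<Rightarrow> real \<times> real \<Rightarrow> real" where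
  "energy g p v = (fst v)\<^sup>2 / 2 + (snd v)\<^sup>2 / 2 + g * snd p"

section \<open>Collisions and the return map\<close>

text \<open>The velocity with which a collision with coordinates \<open>(\<theta>, \<omega>)\<close> comes in.\<close>

definition incoming_velocity :: "real \<Rightarrow> real \<Rightarrow> real \<times> real \<Rightarrow> real \<times> real" where
  "incoming_velocity g E = (\<lambda>(\<theta>, \<omega>). (\<omega>, - sqrt (2 * E - 2 * g * \<bar>sin \<theta>\<bar> - \<omega>\<^sup>2)))"

text \<open>The set \<open>\<P>\<^sub>d\<close>. The strict inequality makes the incoming velocity point strictly
  downward; the last condition says that it does not point into the table, so that there is
  a collision. The corners, where no reflection is defined, are left out.\<close>

definition P_down :: "real \<Rightarrow> real \<Rightarrow> (real \<times> real) set" where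
  "P_down g E = {(\<theta>, \<omega>). sin \<theta> \<noteq> 0 \<and> \<omega>\<^sup>2 + 2 * g * \<bar>sin \<theta>\<bar> < 2 * E \<and>
     incoming_velocity g E (\<theta>, \<omega>) \<bullet> inward_normal \<theta> \<le> 0}"

lemma energy_incoming_velocity:
  "(\<theta>, \<omega>) \<in> P_down g E \<Longrightarrow> energy g (boundary_point \<theta>) (incoming_velocity g E (\<theta>, \<omega>)) = E"
  by (auto simp: energy_def P_down_def incoming_velocity_def boundary_point_def field_simps)

definition outgoing_velocity :: "real \<Rightarrow> real \<Rightarrow> real \<times> real \<Rightarrow> real \<times> real" where
  "outgoing_velocity g E z = mirror (inward_normal (fst z)) (incoming_velocity g E z)"

definition theta_dot_plus :: "real \<Rightarrow> real \<Rightarrow> real \<times> real \<Rightarrow> real" where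
  "theta_dot_plus g E = (\<lambda>(\<theta>, \<omega>). 1 / (1 + (cos \<theta>)\<^sup>2) *
     (\<omega> * (sin \<theta>)\<^sup>2 - 2 * sqrt (2 * E - 2 * g * \<bar>sin \<theta>\<bar> - \<omega>\<^sup>2) * cos \<theta> * (sin \<theta> / \<bar>sin \<theta>\<bar>)))"

lemma fst_outgoing_velocity:
  assumes "sin \<theta> \<noteq> 0"
  shows "fst (outgoing_velocity g E (\<theta>, \<omega>)) = theta_dot_plus g E (\<theta>, \<omega>)"
proof -
  define r where "r = sqrt (2 * E - 2 * g * \<bar>sin \<theta>\<bar> - \<omega>\<^sup>2)"
  define m where "m = boundary_slope \<theta>"
  have m2: "m\<^sup>2 = (cos \<theta>)\<^sup>2"
    using assms by (simp add: m_def boundary_slope_def power_mult_distrib sgn_if)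
  have s2: "(sin \<theta>)\<^sup>2 = 1 - m\<^sup>2"
    by (simp add: m2 sin_squared_eq)
  have sgn: "cos \<theta> * (sin \<theta> / \<bar>sin \<theta>\<bar>) = m"
    by (simp add: m_def boundary_slope_def sgn_if)
  have pos: "1 + m\<^sup>2 \<noteq> 0"
    by (smt (verit) zero_le_power2)
  have "fst (outgoing_velocity g E (\<theta>, \<omega>)) =
      \<omega> + 2 * (- \<omega> * m - r) / (m\<^sup>2 + 1) * m"
    by (simp add: outgoing_velocity_def mirror_def inward_normal_def incoming_velocity_def
        inner_prod_def r_def m_def power2_eq_square)
  also have "\<dots> = 1 / (1 + m\<^sup>2) * (\<omega> * (1 - m\<^sup>2) - 2 * r * m)"
    using pos by (simp add: field_simps power2_eq_square)
  also have "\<dots> = theta_dot_plus g E (\<theta>, \<omega>)"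
  proof -
    have "theta_dot_plus g E (\<theta>, \<omega>) = 1 / (1 + (cos \<theta>)\<^sup>2) *
        (\<omega> * (sin \<theta>)\<^sup>2 - 2 * r * (cos \<theta> * (sin \<theta> / \<bar>sin \<theta>\<bar>)))"
      by (simp add: theta_dot_plus_def r_def mult.assoc)
    then show ?thesis
      unfolding sgn s2 m2[symmetric] by simp
  qed
  finally show ?thesis .
qed

definition next_collision_time :: "real \<Rightarrow> real \<times> real \<Rightarrow> real \<times> real \<Rightarrow> real \<Rightarrow> bool" where
  "next_collision_time g p v t \<longleftrightarrow> t > 0 \<and>
     flight g p v t \<in> range boundary_point \<and>
     (\<forall>s. 0 < s \<and> s < t \<longrightarrow> flight g p v s \<in> billiard_table - range boundary_point)"

text \<open>The return map is only partially defined: the next collision may be in a corner, or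
  its incoming velocity may point upward, in which case \<open>(\<theta>, \<omega>)\<close> are not
  coordinates for it. Partial maps are represented by their graphs.\<close>

definition return_graph :: "real \<Rightarrow> real \<Rightarrow> ((real \<times> real) \<times> (real \<times> real)) set" where
  "return_graph g E = {(z, z1). z \<in> P_down g E \<and> z1 \<in> P_down g E \<and>
     (\<exists>t. next_collision_time g (boundary_point (fst z)) (outgoing_velocity g E z) t \<and>
       flight g (boundary_point (fst z)) (outgoing_velocity g E z) t = boundary_point (fst z1) \<and>
       flight_velocity g (outgoing_velocity g E z) t = incoming_velocity g E z1)}"

section \<open>The domain\<close>

definition D_left :: "real \<Rightarrow> real \<Rightarrow> real \<Rightarrow> (real \<times> real) set" where
  "D_left g E k = {(\<theta>, \<omega>) \<in> P_down g E.
     \<bar>\<theta> - pi / 2\<bar> \<le> k / E \<and> \<bar>\<omega>\<bar> \<le> sqrt 2 * k / sqrt E}"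

definition D_right :: "real \<Rightarrow> real \<Rightarrow> real \<Rightarrow> (real \<times> real) set" where
  "D_right g E k = {(\<theta>, \<omega>) \<in> P_down g E.
     \<bar>\<theta> - 3 * pi / 2\<bar> \<le> k / E \<and> \<bar>\<omega>\<bar> \<le> sqrt 2 * k / sqrt E}"

definition corner_point :: "real \<Rightarrow> real \<Rightarrow> real \<times> real" where
  "corner_point E k = (pi / 2 - k / E, sqrt 2 * k / sqrt E)"

definition corner_condition :: "real \<Rightarrow> real \<Rightarrow> real \<Rightarrow> bool" where
  "corner_condition g E k \<longleftrightarrow>
     (let a = corner_point E k; w = theta_dot_plus g E a in
       2 / g * (w * sqrt (2 * E - 2 * g * \<bar>sin (fst a)\<bar> - w\<^sup>2)) + pi = 0)"

section \<open>The quotient cylinder\<close>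

text \<open>The quotient of the line by translations by multiples of \<open>2 * pi\<close> is
  realised as the unit circle in the complex plane, through \<open>cis \<theta> = exp (\<i> \<theta>)\<close>.
  The cylinder is thus \<open>sphere 0 1 \<times> UNIV\<close>, and its topology is
  induced from \<open>complex \<times> real\<close>.\<close>

definition to_cylinder :: "real \<times> real \<Rightarrow> complex \<times> real" where
  "to_cylinder z = (cis (fst z), snd z)"

lemma to_cylinder_eq_iff:
  "to_cylinder z = to_cylinder z' \<longleftrightarrow>
     (\<exists>n::int. fst z' = fst z + 2 * pi * of_int n) \<and> snd z' = snd z"
proof -
  have "cis (fst z) = cis (fst z') \<longleftrightarrow> (\<exists>n::int. fst z' = fst z + 2 * pi * of_int n)"
    using sin_cos_eq_iff[of "fst z'" "fst z"] by (auto simp: complex_eq_iff)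
  then show ?thesis
    by (auto simp: to_cylinder_def)
qed

definition cyl_return_graph :: "real \<Rightarrow> real \<Rightarrow> ((complex \<times> real) \<times> (complex \<times> real)) set" where
  "cyl_return_graph g E = map_prod to_cylinder to_cylinder ` return_graph g E"

definition coin_map :: "real \<Rightarrow> real \<Rightarrow> complex \<times> real \<Rightarrow> complex \<times> real" where
  "coin_map g E w = (THE w1. (w, w1) \<in> cyl_return_graph g E)"

definition D_cyl :: "real \<Rightarrow> real \<Rightarrow> real \<Rightarrow> (complex \<times> real) set" where
  "D_cyl g E k = to_cylinder ` D_left g E k \<union> to_cylinder ` D_right g E k"

text \<open>Integer iterates of a partial map given by its graph. The image of a set under a
  negative iterate is its preimage under the corresponding positive iterate.\<close>

definition graph_iterate :: "('a \<times> 'a) set \<Rightarrow> int \<Rightarrow> ('a \<times> 'a) set" where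
  "graph_iterate G n = (if 0 \<le> n then G ^^ nat n else (G\<inverse>) ^^ nat (- n))"

definition coin_invariant_set :: "real \<Rightarrow> real \<Rightarrow> real \<Rightarrow> (complex \<times> real) set" where
  "coin_invariant_set g E k = (\<Inter>n::int. graph_iterate (cyl_return_graph g E) n `` D_cyl g E k)"

section \<open>The shift space\<close>

datatype coin_symbol = L1 | L2 | L3 | R1 | R2 | R3

definition may_follow :: "coin_symbol \<Rightarrow> coin_symbol \<Rightarrow> bool" where
  "may_follow a b \<longleftrightarrow>
     a \<in> {L1, L2, L3} \<and> b \<in> {R1, L2, R3} \<or> a \<in> {R1, R2, R3} \<and> b \<in> {L1, R2, L3}"

definition coin_sequences :: "(int \<Rightarrow> coin_symbol) set" where
  "coin_sequences = {s. \<forall>i. may_follow (s i) (s (i + 1))}"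

definition coin_sequence_topology :: "(int \<Rightarrow> coin_symbol) topology" where
  "coin_sequence_topology =
     subtopology (product_topology (\<lambda>_. discrete_topology UNIV) UNIV) coin_sequences"

definition shift :: "(int \<Rightarrow> 'a) \<Rightarrow> int \<Rightarrow> 'a" where
  "shift s = (\<lambda>i. s (i + 1))"

section \<open>The return map is well defined\<close>

lemma next_collision_time_unique:
  assumes "next_collision_time g p v t" "next_collision_time g p v t'"
  shows "t = t'"
  using assms unfolding next_collision_time_def
  by (metis DiffD2 linorder_neqE_linordered_idom)

lemma single_valued_return_graph: "single_valued (return_graph g E)"
proof (rule single_valuedI)
  fix z z1 z2
  assume 1: "(z, z1) \<in> return_graph g E" and 2: "(z, z2) \<in> return_graph g E"
  from 1 2 have "boundary_point (fst z1) = boundary_point (fst z2)"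
    and "incoming_velocity g E z1 = incoming_velocity g E z2"
    unfolding return_graph_def using next_collision_time_unique by fastforce+
  then show "z1 = z2"
    by (cases z1; cases z2) (simp add: boundary_point_def incoming_velocity_def)
qed

lemma return_graph_translate:
  assumes "((\<theta>, \<omega>), (\<theta>1, \<omega>1)) \<in> return_graph g E"
  shows "((\<theta> + 2 * pi * of_int n, \<omega>), (\<theta>1 + 2 * pi * of_int n, \<omega>1)) \<in> return_graph g E"
proof -
  define c where "c = 2 * pi * real_of_int n"
  have sc: "sin (x + c) = sin x" "cos (x + c) = cos x" for x
    unfolding c_def by (simp_all add: sin_add cos_add)
  have iv: "incoming_velocity g E (x + c, \<alpha>) = incoming_velocity g E (x, \<alpha>)" for x \<alpha>
    by (simp add: incoming_velocity_def sc)
  have nn: "inward_normal (x + c) = inward_normal x" for x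
    by (simp add: inward_normal_def boundary_slope_def sc)
  have ov: "outgoing_velocity g E (x + c, \<alpha>) = outgoing_velocity g E (x, \<alpha>)" for x \<alpha>
    by (simp add: outgoing_velocity_def iv nn)
  have P: "(x + c, \<alpha>) \<in> P_down g E \<longleftrightarrow> (x, \<alpha>) \<in> P_down g E" for x \<alpha>
    by (simp add: P_down_def iv nn sc)
  have bp: "boundary_point (x + c) = boundary_point x + (c, 0)" for x
    by (simp add: boundary_point_def sc)
  have fl: "flight g (p + (c, 0)) v t = flight g p v t + (c, 0)" for p v t
    by (simp add: flight_def prod_eq_iff)
  have table: "p + (c, 0) \<in> billiard_table \<longleftrightarrow> p \<in> billiard_table" for p
    by (cases p) (simp add: billiard_table_def sc)
  have bd: "p + (c, 0) \<in> range boundary_point \<longleftrightarrow> p \<in> range boundary_point" for p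
    by (cases p) (auto simp: boundary_point_def image_iff sc)
  have "next_collision_time g (p + (c, 0)) v t \<longleftrightarrow> next_collision_time g p v t" for p v t
    by (simp add: next_collision_time_def fl table bd)
  with assms show ?thesis
    unfolding c_def[symmetric] by (simp add: return_graph_def P ov iv bp fl)
qed

lemma single_valued_cyl_return_graph: "single_valued (cyl_return_graph g E)"
proof (rule single_valuedI)
  fix w w1 w2
  assume "(w, w1) \<in> cyl_return_graph g E" and "(w, w2) \<in> cyl_return_graph g E"
  then obtain z z1 z' z2
    where 1: "(z, z1) \<in> return_graph g E" "w = to_cylinder z" "w1 = to_cylinder z1"
      and 2: "(z', z2) \<in> return_graph g E" "w = to_cylinder z'" "w2 = to_cylinder z2"
    unfolding cyl_return_graph_def by auto
  then obtain n :: int where n: "fst z' = fst z + 2 * pi * of_int n" "snd z' = snd z"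
    using to_cylinder_eq_iff by metis
  have "(z', (fst z1 + 2 * pi * of_int n, snd z1)) \<in> return_graph g E"
    using return_graph_translate[of "fst z" "snd z" "fst z1" "snd z1" g E n] 1(1) n
    by (cases z') simp
  with 2(1) have "z2 = (fst z1 + 2 * pi * of_int n, snd z1)"
    using single_valued_return_graph single_valuedD by metis
  then show "w1 = w2"
    using 1(3) 2(3) to_cylinder_eq_iff[of z1 z2] by auto
qed

lemma coin_map_eq: "(w, w1) \<in> cyl_return_graph g E \<Longrightarrow> coin_map g E w = w1"
  unfolding coin_map_def
  using single_valued_cyl_return_graph by (auto dest: single_valuedD)

end

theory Submission
  imports Defs
begin

text \<open>
At high energy a bounce takes a long time, and a velocity of order \<open>1 / sqrt E\<close> suffices to carry
the point from one bump of the boundary to the next. A collision in the domain is described by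
the number \<open>m\<close> of its bump, the offset \<open>x\<close> from the top, and the angular velocity \<open>sqrt (2 E) q\<close>
with which it comes in; the domain is the square \<open>\<bar>x\<bar> \<le> X\<close>, \<open>\<bar>q\<bar> \<le> X\<close> with \<open>X = k / E\<close>. With
\<open>\<eta> = g / E\<close> and the vertical speed \<open>\<rho>(x, q) = sqrt (1 - \<eta> cos x - q\<^sup>2)\<close>, consecutive collisions
satisfy
\<^item> \<open>q\<^sub>1 - q = sin x (\<rho>(x, q) + \<rho>(x, q\<^sub>1))\<close>, the mirror law, and
\<^item> \<open>q\<^sub>1 (\<rho>(x, q\<^sub>1) + \<rho>(x\<^sub>1, q\<^sub>1)) = (\<pi> n + x\<^sub>1 - x) \<eta> / 2\<close>, the flight over \<open>n\<close> bumps,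

and conversely (\<open>return_graph_state_iff\<close>). In the domain only \<open>n = - 1, 0, 1\<close> occurs.

The proof does not follow stable and unstable manifolds but solves these equations for the whole
orbit at once. Since \<open>\<rho>\<close> is close to \<open>1\<close> and \<open>x\<close> is small, the second equation determines the
velocities by the numbers \<open>n\<close> up to small errors, and the first one determines each offset by
the velocities before and after. Hence the equations are a contraction on bi-infinite
sequences, for every sequence of numbers \<open>n\<close>: there is exactly one solution
(\<open>shadows_exists\<close>, \<open>shadows_unique\<close>), and numbers that are far away in the sequence influence it
exponentially little (\<open>shadows_close\<close>).

The delicate point is that the solution stays in the square. To leading order the velocity is
\<open>n X\<close>, and the offset is half the difference of the next and the present velocity, so that
extreme orbits meet the boundary of the square. The corner condition decides at the next order.
The corner leaves with the speed \<open>p\<close> of a flight by exactly one half turn, while the mirror law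
gives \<open>X - p\<close> of size \<open>\<eta> X\<close> (\<open>corner_gap\<close>). The errors in velocities and offsets are a fraction
of this (\<open>longest_flight_le\<close>, \<open>abs_offset_le_X\<close>).

On the cylinder a bump is known by the parity of \<open>m\<close>, which is the letter of a symbol; its index
is the number \<open>n\<close> of the flight that leads there. The rule for successors says that the parities
fit. So a symbol sequence has exactly one orbit in the domain, and since the return map is
injective on the cylinder (\<open>single_valued_converse_cyl_return_graph\<close>) the points of the invariant
set are exactly the points with such an orbit. The map from sequences to points is
continuous and bijective, from a compact space to a Hausdorff space; its inverse is the desired
conjugacy.
\<close>

section \<open>Chains of locally coupled contractions\<close>

text \<open>Sites \<open>i\<close> on the line carry states in \<open>K\<close> and symbols; an equilibrium is a sequence in which
every state is the image under \<open>F\<close> of its own symbol, itself, and its two neighbours. As \<open>F\<close>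
contracts in all three arguments together, this is a contraction of the bounded sequences with
the supremum distance, for each sequence of symbols.\<close>
locale contracting_chain =
  fixes F :: "'s \<Rightarrow> 'a::complete_space \<Rightarrow> 'a \<Rightarrow> 'a \<Rightarrow> 'a" and K :: "'a set" and c :: real
  assumes closed_K: "closed K" and bounded_K: "bounded K" and nonempty_K: "K \<noteq> {}"
    and c_nonneg: "0 \<le> c" and c_less_1: "c < 1"
    and maps_K: "\<And>s u v w. u \<in> K \<Longrightarrow> v \<in> K \<Longrightarrow> w \<in> K \<Longrightarrow> F s u v w \<in> K"
    and contracts: "\<And>s u v w u' v' w' d. u \<in> K \<Longrightarrow> v \<in> K \<Longrightarrow> w \<in> K \<Longrightarrow> u' \<in> K \<Longrightarrow> v' \<in> K \<Longrightarrow> w' \<in> K \<Longrightarrow>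
      dist u u' \<le> d \<Longrightarrow> dist v v' \<le> d \<Longrightarrow> dist w w' \<le> d \<Longrightarrow> dist (F s u v w) (F s u' v' w') \<le> c * d"
begin

definition solves :: "(int \<Rightarrow> 's) \<Rightarrow> (int \<Rightarrow> 'a) \<Rightarrow> bool" where
  "solves s z \<longleftrightarrow> (\<forall>i. z i \<in> K \<and> z i = F (s i) (z (i - 1)) (z i) (z (i + 1)))"

lemma solvesD:
  assumes "solves s z"
  shows "z i \<in> K" "F (s i) (z (i - 1)) (z i) (z (i + 1)) = z i"
proof -
  have "z i \<in> K \<and> z i = F (s i) (z (i - 1)) (z i) (z (i + 1))"
    using assms unfolding solves_def by (rule spec)
  then show "z i \<in> K" "F (s i) (z (i - 1)) (z i) (z (i + 1)) = z i"
    by (rule conjunct1, rule conjunct2[THEN sym])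
qed

text \<open>Every application of the equations reaches one site further and gains a factor \<open>c\<close>: symbols at
distance at least \<open>m\<close> influence a state by at most \<open>c ^ m\<close> times the diameter. This yields uniqueness
and the continuity of the coding.\<close>
lemma solution_depends_locally_on_symbols:
  assumes z: "solves s z" and z': "solves s' z'" and "\<forall>i. \<bar>i - j\<bar> < int m \<longrightarrow> s i = s' i"
  shows "dist (z j) (z' j) \<le> c ^ m * diameter K"
  using assms(3)
proof (induction m arbitrary: j)
  case 0
  then show ?case
    using diameter_bounded_bound[OF bounded_K solvesD(1)[OF z] solvesD(1)[OF z']] by simp
next
  case (Suc m)
  have IH: "dist (z j') (z' j') \<le> c ^ m * diameter K" if "\<bar>j' - j\<bar> \<le> 1" for j'
  proof (rule Suc.IH, intro allI impI)
    fix i assume "\<bar>i - j'\<bar> < int m"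
    with that have "\<bar>i - j\<bar> < int (Suc m)" by simp
    with Suc.prems show "s i = s' i" by blast
  qed
  have "dist (F (s j) (z (j - 1)) (z j) (z (j + 1))) (F (s j) (z' (j - 1)) (z' j) (z' (j + 1)))
      \<le> c * (c ^ m * diameter K)"
    by (intro contracts IH solvesD(1)[OF z] solvesD(1)[OF z']) simp_all
  moreover have "s j = s' j"
    using Suc.prems by simp
  ultimately show ?case
    using solvesD(2)[OF z, of j] solvesD(2)[OF z', of j] by (simp add: mult.assoc)
qed

lemma solution_unique:
  assumes "solves s z" "solves s z'"
  shows "z = z'"
proof
  fix j
  have "(\<lambda>m. c ^ m * diameter K) \<longlonglongrightarrow> 0 * diameter K"
    using c_nonneg c_less_1 by (intro tendsto_intros LIMSEQ_power_zero) simp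
  moreover have "dist (z j) (z' j) \<le> c ^ m * diameter K" for m
    by (rule solution_depends_locally_on_symbols[OF assms]) simp
  ultimately have "dist (z j) (z' j) \<le> 0 * diameter K"
    by (intro LIMSEQ_le_const) blast+
  then show "z j = z' j"
    by simp
qed

lemma solution_exists: "\<exists>z. solves s z"
proof -
  obtain u where u: "u \<in> K"
    using nonempty_K by blast
  define Z where "Z = rec_nat (\<lambda>_. u) (\<lambda>_ z i. F (s i) (z (i - 1)) (z i) (z (i + 1)))"
  have Z_Suc: "Z (Suc m) i = F (s i) (Z m (i - 1)) (Z m i) (Z m (i + 1))" for m i
    by (simp add: Z_def)
  have Z_in: "Z m i \<in> K" for m i
    by (induction m arbitrary: i) (auto simp: Z_def u intro: maps_K)
  have Z_dist: "dist (Z m i) (Z (m + p) i) \<le> c ^ m * diameter K" for m p i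
  proof (induction m arbitrary: i)
    case 0
    then show ?case
      using diameter_bounded_bound[OF bounded_K] Z_in by simp
  next
    case (Suc m)
    have "dist (Z (Suc m) i) (Z (Suc (m + p)) i) \<le> c * (c ^ m * diameter K)"
      unfolding Z_Suc by (intro contracts Z_in Suc.IH)
    then show ?case
      by (simp add: mult.assoc)
  qed
  have small: "(\<lambda>m. c ^ m * diameter K) \<longlonglongrightarrow> 0 * diameter K"
    using c_nonneg c_less_1 by (intro tendsto_intros LIMSEQ_power_zero) simp
  have "Cauchy (\<lambda>m. Z m i)" for i
  proof (rule metric_CauchyI)
    fix e :: real
    assume "e > 0"
    then obtain M where M: "c ^ M * diameter K < e / 2"
      using order_tendstoD(2)[OF small, of "e / 2"] by (auto simp: eventually_sequentially)
    have "dist (Z m i) (Z n i) < e" if "m \<ge> M" "n \<ge> M" for m n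
      using Z_dist[of M i "m - M"] Z_dist[of M i "n - M"] that M
        dist_triangle3[of "Z m i" "Z n i" "Z M i"] by simp
    then show "\<exists>M. \<forall>m\<ge>M. \<forall>n\<ge>M. dist (Z m i) (Z n i) < e"
      by blast
  qed
  then obtain z where z: "\<And>i. (\<lambda>m. Z m i) \<longlonglongrightarrow> z i"
    unfolding Cauchy_convergent_iff convergent_def by metis
  have z_in: "z i \<in> K" for i
    using closed_sequentially[OF closed_K _ z] Z_in by blast
  have Z_z: "dist (Z m i) (z i) \<le> c ^ m * diameter K" for m i
  proof (rule LIMSEQ_le_const2)
    show "(\<lambda>p. dist (Z m i) (Z (p + m) i)) \<longlonglongrightarrow> dist (Z m i) (z i)"
      by (intro tendsto_intros LIMSEQ_ignore_initial_segment z)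
    show "\<exists>N. \<forall>p\<ge>N. dist (Z m i) (Z (p + m) i) \<le> c ^ m * diameter K"
      using Z_dist by (auto simp: add.commute[of _ m])
  qed
  have "z i = F (s i) (z (i - 1)) (z i) (z (i + 1))" for i
  proof -
    have "dist (z i) (F (s i) (z (i - 1)) (z i) (z (i + 1))) \<le> 2 * (c ^ Suc m * diameter K)" for m
    proof -
      have "dist (Z (Suc m) i) (F (s i) (z (i - 1)) (z i) (z (i + 1))) \<le> c * (c ^ m * diameter K)"
        unfolding Z_Suc by (intro contracts Z_in z_in Z_z)
      then show ?thesis
        using Z_z[of "Suc m" i] dist_triangle3[of "z i" "F (s i) (z (i - 1)) (z i) (z (i + 1))" "Z (Suc m) i"]
        by (simp add: mult.assoc)
    qed
    moreover have "(\<lambda>m. 2 * (c ^ Suc m * diameter K)) \<longlonglongrightarrow> 2 * (0 * diameter K)"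
      by (rule tendsto_mult[OF tendsto_const LIMSEQ_Suc[OF small]])
    ultimately have "dist (z i) (F (s i) (z (i - 1)) (z i) (z (i + 1))) \<le> 2 * (0 * diameter K)"
      by (intro LIMSEQ_le_const) blast+
    then show ?thesis
      by simp
  qed
  with z_in show ?thesis
    unfolding solves_def by blast
qed

end

section \<open>Collisions and flights in units of the energy\<close>

text \<open>Near the top of the \<open>m\<close>-th bump write \<open>\<theta> = \<pi>/2 + \<pi> m + x\<close>, measure velocities in
units of \<open>sqrt (2 E)\<close>, and put \<open>\<eta> = g / E\<close>. Then \<open>rho \<eta> x q\<close> is the vertical speed that
energy conservation leaves to a point of the boundary with offset \<open>x\<close> and angular velocity
\<open>q\<close>.\<close>
definition rho :: "real \<Rightarrow> real \<Rightarrow> real \<Rightarrow> real" where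
  "rho \<eta> x q = sqrt (1 - \<eta> * cos x - q\<^sup>2)"

text \<open>The slope of the boundary at offset \<open>x\<close> is \<open>- sin x\<close> and the vertical velocity jumps from
\<open>- rho \<eta> x q\<close> to \<open>rho \<eta> x q1\<close>. The mirror law keeps the speed and changes the velocity by a
multiple of the normal \<open>(sin x, 1)\<close>; in this form it treats the times before and after the
collision alike.\<close>
definition reflects :: "real \<Rightarrow> real \<Rightarrow> real \<Rightarrow> real \<Rightarrow> bool" where
  "reflects \<eta> x q q1 \<longleftrightarrow> q1 - q = sin x * (rho \<eta> x q + rho \<eta> x q1)"

text \<open>A flight from offset \<open>x\<close> at one top to offset \<open>x1\<close> at the \<open>n\<close>-th next top. It leaves with
vertical speed \<open>rho \<eta> x q\<close> and arrives with \<open>rho \<eta> x1 q\<close>, and gravity needs a time proportional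
to the sum of the two for this change; multiplied by \<open>q\<close> it gives the angle travelled.\<close>
definition flies :: "real \<Rightarrow> int \<Rightarrow> real \<Rightarrow> real \<Rightarrow> real \<Rightarrow> bool" where
  "flies \<eta> n x x1 q \<longleftrightarrow> q * (rho \<eta> x q + rho \<eta> x1 q) = \<eta> / 2 * (pi * of_int n + x1 - x)"

lemma one_minus_cos_le: "1 - cos x \<le> x\<^sup>2 / 2" for x :: real
proof -
  have "(sin (x / 2))\<^sup>2 \<le> (x / 2)\<^sup>2"
    using abs_sin_x_le_abs_x[of "x / 2"] by (simp only: abs_le_square_iff)
  then show ?thesis
    using cos_double_sin[of "x / 2"] by (simp add: power_divide)
qed

lemma abs_cos_diff_le: "\<bar>cos x - cos y\<bar> \<le> \<bar>x - y\<bar>" for x y :: real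
proof -
  have "\<bar>cos x - cos y\<bar> = 2 * (\<bar>sin ((x + y) / 2)\<bar> * \<bar>sin ((y - x) / 2)\<bar>)"
    by (simp add: cos_diff_cos abs_mult)
  also have "\<dots> \<le> 2 * (1 * \<bar>(y - x) / 2\<bar>)"
    by (intro mult_left_mono mult_mono abs_sin_le_one abs_sin_x_le_abs_x) auto
  finally show ?thesis
    by (simp add: abs_minus_commute)
qed

text \<open>The offset \<open>x\<close> enters the mirror law through \<open>sin x\<close>. Writing \<open>sin x = y\<close> as the fixed point
equation \<open>x = (x - sin x) + y\<close> avoids the inverse sine, at the price of this small constant.\<close>
lemma self_minus_sin_lipschitz:
  fixes x y :: real
  assumes "\<bar>x\<bar> \<le> 1 / 50" "\<bar>y\<bar> \<le> 1 / 50"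
  shows "\<bar>(x - sin x) - (y - sin y)\<bar> \<le> \<bar>x - y\<bar> / 1000"
proof -
  have "norm ((x - sin x) - (y - sin y)) \<le> 1 / 1000 * norm (x - y)"
  proof (rule field_differentiable_bound[where S = "{-1/50..1/50}" and f' = "\<lambda>z. 1 - cos z"])
    fix z :: real
    assume z: "z \<in> {-1/50..1/50}"
    show "((\<lambda>x. x - sin x) has_field_derivative 1 - cos z) (at z within {-1/50..1/50})"
      by (auto intro!: derivative_eq_intros)
    have "z\<^sup>2 \<le> (1 / 50)\<^sup>2"
      using z by (intro power2_le_iff_abs_le[THEN iffD2]) auto
    then show "norm (1 - cos z) \<le> 1 / 1000"
      using one_minus_cos_le[of z] by (simp add: power_divide)
  qed (use assms in auto)
  then show ?thesis
    by simp
qed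

lemma quotient_diff_le:
  fixes N N' D D' :: real
  assumes "D \<ge> 1" "D' \<ge> 1"
  shows "\<bar>N / D - N' / D'\<bar> \<le> \<bar>N - N'\<bar> + \<bar>N'\<bar> * \<bar>D - D'\<bar>"
proof -
  have "N / D - N' / D' = (N - N') / D + N' * (D' - D) / (D * D')"
    using assms by (simp add: field_simps)
  also have "\<bar>\<dots>\<bar> \<le> \<bar>N - N'\<bar> / D + \<bar>N'\<bar> * \<bar>D - D'\<bar> / (D * D')"
    using assms by (intro order_trans[OF abs_triangle_ineq]) (simp add: abs_mult abs_minus_commute)
  also have "\<dots> \<le> \<bar>N - N'\<bar> / 1 + \<bar>N'\<bar> * \<bar>D - D'\<bar> / (1 * 1)"
    using assms by (intro add_mono divide_left_mono mult_mono) auto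
  finally show ?thesis
    by simp
qed

section \<open>The corner condition at leading and next order\<close>

text \<open>Here \<open>X = k / E\<close> bounds offsets as well as angular velocities, since
\<open>sqrt 2 * k / sqrt E = sqrt (2 * E) * X\<close>. The corner point has offset \<open>- X\<close> and incoming
velocity \<open>X\<close>; it leaves with velocity \<open>- p\<close>. The last assumption says that this is exactly
the speed of a flight by one half turn between points of equal height. The numerical bounds are not
sharp; they hold at high energy.\<close>
locale small_parameters =
  fixes \<eta> X p :: real
  assumes eta_pos: "0 < \<eta>" and eta_small: "\<eta> \<le> 1 / 100"
    and X_pos: "0 < X" and X_small: "X \<le> 1 / 100" and X_square_small: "X\<^sup>2 \<le> \<eta> / 100"
    and corner_reflection: "p * (1 + (sin X)\<^sup>2) = 2 * rho \<eta> X X * sin X - X * (cos X)\<^sup>2"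
    and corner_flight: "p * rho \<eta> X p = pi * \<eta> / 4"
begin

text \<open>These bound \<open>rho\<close> for offsets up to \<open>3 X / 2\<close> and velocities up to \<open>X\<close>. Both are
\<open>1 - \<eta> / 2\<close> up to terms of second order: the leading correction, due to gravity, is common to
all relevant states, so that the spread of \<open>rho\<close> is negligible against \<open>\<eta>\<close>.\<close>
definition rho_min :: real where "rho_min = sqrt (1 - \<eta> - X\<^sup>2)"
definition rho_max :: real where "rho_max = sqrt (1 - \<eta> + X\<^sup>2)"

lemma rho_radicand_bounds:
  assumes "\<bar>x\<bar> \<le> 3 * X / 2" "\<bar>q\<bar> \<le> X"
  shows "1 - \<eta> - X\<^sup>2 \<le> 1 - \<eta> * cos x - q\<^sup>2" "1 - \<eta> * cos x - q\<^sup>2 \<le> 1 - \<eta> + X\<^sup>2"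
proof -
  have q: "q\<^sup>2 \<le> X\<^sup>2"
    using assms X_pos by (intro power2_le_iff_abs_le[THEN iffD2]) auto
  have "\<eta> * cos x \<le> \<eta>"
    using eta_pos by simp
  with q show "1 - \<eta> - X\<^sup>2 \<le> 1 - \<eta> * cos x - q\<^sup>2"
    by simp
  have "x\<^sup>2 \<le> (3 * X / 2)\<^sup>2"
    using assms X_pos by (intro power2_le_iff_abs_le[THEN iffD2]) auto
  then have "1 - cos x \<le> 9 / 8 * X\<^sup>2"
    using one_minus_cos_le[of x] by (simp add: power_divide power_mult_distrib)
  then have "\<eta> * (1 - cos x) \<le> 1 / 100 * (9 / 8 * X\<^sup>2)"
    using eta_pos eta_small by (intro mult_mono) auto
  then have "\<eta> * (1 - cos x) \<le> X\<^sup>2"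
    using zero_le_power2[of X] by linarith
  moreover have "q\<^sup>2 \<ge> 0"
    by simp
  ultimately show "1 - \<eta> * cos x - q\<^sup>2 \<le> 1 - \<eta> + X\<^sup>2"
    unfolding right_diff_distrib by linarith
qed

lemma rho_bounds:
  assumes "\<bar>x\<bar> \<le> 3 * X / 2" "\<bar>q\<bar> \<le> X"
  shows "rho_min \<le> rho \<eta> x q" "rho \<eta> x q \<le> rho_max"
  using rho_radicand_bounds[OF assms] by (simp_all add: rho_def rho_min_def rho_max_def)

lemma X_square_tiny: "X\<^sup>2 \<le> 1 / 10000"
  using X_square_small eta_small by simp

lemma rho_min_ge: "99 / 100 \<le> rho_min"
  unfolding rho_min_def using X_square_tiny eta_small
  by (intro real_le_rsqrt) (simp add: power2_eq_square)

lemma rho_max_le: "rho_max \<le> 1"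
  unfolding rho_max_def using X_square_small eta_pos by simp

lemma rho_min_le_max: "rho_min \<le> rho_max"
  unfolding rho_min_def rho_max_def by simp

lemma rho_squared:
  assumes "\<bar>x\<bar> \<le> 3 * X / 2" "\<bar>q\<bar> \<le> X"
  shows "(rho \<eta> x q)\<^sup>2 = 1 - \<eta> * cos x - q\<^sup>2"
  using rho_radicand_bounds(1)[OF assms] X_square_tiny eta_small
  by (simp add: rho_def)

lemma rho_ge: "\<bar>x\<bar> \<le> 3 * X / 2 \<Longrightarrow> \<bar>q\<bar> \<le> X \<Longrightarrow> 99 / 100 \<le> rho \<eta> x q"
  using rho_bounds(1)[of x q] rho_min_ge by simp

lemma rho_le: "\<bar>x\<bar> \<le> 3 * X / 2 \<Longrightarrow> \<bar>q\<bar> \<le> X \<Longrightarrow> rho \<eta> x q \<le> 1"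
  using rho_bounds(2)[of x q] rho_max_le by simp

lemma rho_max_minus_min_le: "rho_max - rho_min \<le> 11 / 10 * X\<^sup>2"
proof -
  have "rho_max\<^sup>2 - rho_min\<^sup>2 = 2 * X\<^sup>2"
    unfolding rho_max_def rho_min_def using X_square_tiny eta_small by simp
  then have "(rho_max - rho_min) * (rho_max + rho_min) = 2 * X\<^sup>2"
    by (simp add: algebra_simps power2_eq_square)
  moreover have "198 / 100 * (rho_max - rho_min) \<le> (rho_max + rho_min) * (rho_max - rho_min)"
    using rho_min_ge rho_min_le_max by (intro mult_right_mono) auto
  ultimately have "198 / 100 * (rho_max - rho_min) \<le> 2 * X\<^sup>2"
    by (simp only: mult.commute)
  then show ?thesis
    using zero_le_power2[of X] by argo
qed

lemma rho_spread_le: "rho_max - rho_min \<le> 11 / 1000 * \<eta>"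
  using rho_max_minus_min_le X_square_small by simp

text \<open>The vertical speed hardly depends on the state; this makes the equations of motion weakly
coupled.\<close>
lemma rho_lipschitz:
  assumes "\<bar>x\<bar> \<le> 3 * X / 2" "\<bar>q\<bar> \<le> X" "\<bar>x'\<bar> \<le> 3 * X / 2" "\<bar>q'\<bar> \<le> X"
  shows "\<bar>rho \<eta> x q - rho \<eta> x' q'\<bar> \<le> (\<bar>x - x'\<bar> + \<bar>q - q'\<bar>) / 50"
proof -
  define r r' where r: "r = rho \<eta> x q" and r': "r' = rho \<eta> x' q'"
  have "(r - r') * (r + r') = - (\<eta> * (cos x - cos x')) - (q - q') * (q + q')"
    using rho_squared[OF assms(1,2)] rho_squared[OF assms(3,4)] unfolding r[symmetric] r'[symmetric]
    by (simp add: algebra_simps power2_eq_square)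
  moreover have "\<bar>\<eta> * (cos x - cos x')\<bar> \<le> 1 / 100 * \<bar>x - x'\<bar>"
    unfolding abs_mult using eta_pos eta_small by (intro mult_mono abs_cos_diff_le) auto
  moreover have "\<bar>(q - q') * (q + q')\<bar> \<le> \<bar>q - q'\<bar> * (2 / 100)"
  proof -
    have "\<bar>q + q'\<bar> \<le> 2 / 100"
      using assms X_small by linarith
    then show ?thesis
      unfolding abs_mult by (intro mult_left_mono) auto
  qed
  ultimately have "\<bar>r - r'\<bar> * \<bar>r + r'\<bar> \<le> (\<bar>x - x'\<bar> + \<bar>q - q'\<bar>) / 50"
    unfolding abs_mult[symmetric] by argo
  moreover have "\<bar>r - r'\<bar> * 1 \<le> \<bar>r - r'\<bar> * \<bar>r + r'\<bar>"
    using rho_ge[OF assms(1,2)] rho_ge[OF assms(3,4)] unfolding r[symmetric] r'[symmetric]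
    by (intro mult_left_mono) auto
  ultimately show ?thesis
    unfolding r r' by simp
qed

lemma sin_X_bounds: "99 / 100 * X \<le> sin X" "sin X \<le> X" "0 \<le> sin X"
proof -
  have "\<bar>(X - sin X) - (0 - sin 0)\<bar> \<le> \<bar>X - 0\<bar> / 1000"
    using X_pos X_small by (intro self_minus_sin_lipschitz) auto
  then show "99 / 100 * X \<le> sin X" "sin X \<le> X" "0 \<le> sin X"
    using X_pos sin_x_le_x[of X] by auto
qed

text \<open>If the vertical speed were \<open>1\<close>, the mirror law would turn \<open>X\<close> into \<open>- X\<close> at the corner. The
actual speed is smaller by \<open>\<eta> / 2\<close>, and the reflected velocity is therefore smaller by about
\<open>\<eta> X\<close>. This gap is the room that keeps the orbits below inside the domain.\<close>
lemma corner_gap: "98 / 100 * (\<eta> * X) \<le> X - p" "X - p \<le> 4 / 100 * X"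
proof -
  define s where "s = (sin X)\<^sup>2"
  have s: "0 \<le> s" "s \<le> 1 / 10000"
    unfolding s_def using power_mono[OF sin_X_bounds(2,3), of 2] X_square_tiny by auto
  have cs: "(cos X)\<^sup>2 = 1 - s"
    by (simp add: s_def cos_squared_eq)
  have gap: "(X - p) * (1 + s) = 2 * (X - rho \<eta> X X * sin X)"
    using corner_reflection unfolding cs s_def[symmetric] by (simp add: algebra_simps)
  have r: "99 / 100 \<le> rho \<eta> X X" "rho \<eta> X X \<le> 1"
    using rho_ge[of X X] rho_le[of X X] X_pos by auto
  have "1 - cos X \<le> 1 / 100"
    using one_minus_cos_le[of X] X_square_tiny by simp
  then have "\<eta> * (99 / 100) \<le> \<eta> * cos X"
    using eta_pos by (intro mult_left_mono) auto
  moreover have "(rho \<eta> X X)\<^sup>2 = 1 - \<eta> * cos X - X\<^sup>2"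
    using X_pos by (intro rho_squared) auto
  moreover have "1 - (rho \<eta> X X)\<^sup>2 \<le> 2 * (1 - rho \<eta> X X)"
    using zero_le_power2[of "1 - rho \<eta> X X"] by (simp add: power2_eq_square algebra_simps)
  ultimately have "\<eta> * (99 / 100) \<le> 2 * (1 - rho \<eta> X X)"
    using zero_le_power2[of X] by linarith
  then have "X * (\<eta> * (99 / 100)) \<le> X * (2 * (1 - rho \<eta> X X))"
    using X_pos by (intro mult_left_mono) auto
  moreover have "rho \<eta> X X * sin X \<le> rho \<eta> X X * X"
    using r sin_X_bounds by (intro mult_left_mono) auto
  ultimately have lo: "99 / 100 * (\<eta> * X) \<le> (X - p) * (1 + s)"
    unfolding gap by (simp add: algebra_simps)
  have "99 / 100 * (99 / 100 * X) \<le> rho \<eta> X X * sin X"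
    using r sin_X_bounds X_pos by (intro mult_mono) auto
  then have hi: "(X - p) * (1 + s) \<le> 4 / 100 * X"
    unfolding gap using X_pos by simp
  have "0 \<le> (X - p) * (1 + s)"
    using lo eta_pos X_pos by (intro order_trans[OF _ lo]) simp
  then have pos: "0 \<le> X - p"
    using s by (simp add: zero_le_mult_iff)
  have "(X - p) * 1 \<le> (X - p) * (1 + s)"
    using pos s by (intro mult_left_mono) auto
  with hi show "X - p \<le> 4 / 100 * X"
    by simp
  have "(X - p) * (1 + s) \<le> (X - p) * (10001 / 10000)"
    using pos s by (intro mult_left_mono) auto
  with lo have "99 / 100 * (\<eta> * X) \<le> (X - p) * (10001 / 10000)"
    by (rule order_trans)
  moreover have "0 < \<eta> * X"
    using eta_pos X_pos by simp
  ultimately show "98 / 100 * (\<eta> * X) \<le> X - p"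
    by argo
qed

lemma p_bounds: "96 / 100 * X \<le> p" "p \<le> X" "0 \<le> p"
proof -
  have "0 \<le> \<eta> * X"
    using eta_pos X_pos by simp
  then show "p \<le> X"
    using corner_gap(1) by simp
qed (use corner_gap(2) X_pos in simp_all)

lemma corner_flight_bounds: "p * rho_min \<le> pi * \<eta> / 4" "pi * \<eta> / 4 \<le> p * rho_max"
proof -
  have "\<bar>X\<bar> \<le> 3 * X / 2" "\<bar>p\<bar> \<le> X"
    using p_bounds X_pos by auto
  from rho_bounds[OF this] show "p * rho_min \<le> pi * \<eta> / 4" "pi * \<eta> / 4 \<le> p * rho_max"
    unfolding corner_flight[symmetric] using p_bounds by (auto intro: mult_left_mono)
qed

text \<open>A flight by one half turn has about the speed \<open>p\<close>, and an extra angle \<open>3 X\<close> costs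
\<open>3 \<eta> X / 4\<close>, less than the gap \<open>X - p\<close>. Offsets up to \<open>3 X / 2\<close> thus never need a velocity
above \<open>X\<close>.\<close>
lemma longest_flight_le: "\<eta> / 2 * (pi + 3 * X) \<le> 2 * rho_min * X"
proof -
  have "p * (rho_max - rho_min) \<le> X * (11 / 1000 * \<eta>)"
    using p_bounds rho_spread_le rho_min_le_max X_pos by (intro mult_mono) auto
  moreover have "99 / 100 * (98 / 100 * (\<eta> * X)) \<le> rho_min * (X - p)"
    using rho_min_ge corner_gap(1) eta_pos X_pos by (intro mult_mono) auto
  moreover have "0 < \<eta> * X"
    using eta_pos X_pos by simp
  ultimately show ?thesis
    using corner_flight_bounds(2) by (simp add: algebra_simps)
qed

lemma flight_speed_le:
  assumes "\<bar>y\<bar> \<le> pi + 3 * X" "2 * rho_min \<le> D"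
  shows "\<bar>\<eta> / 2 * y / D\<bar> \<le> X"
proof -
  have "\<bar>\<eta> / 2 * y\<bar> \<le> \<eta> / 2 * (pi + 3 * X)"
    using assms(1) eta_pos by (simp add: abs_mult)
  also have "\<dots> \<le> 2 * rho_min * X"
    by (rule longest_flight_le)
  also have "\<dots> \<le> D * X"
    using assms(2) X_pos by (intro mult_right_mono) auto
  finally show ?thesis
    using assms(2) rho_min_ge by (simp add: pos_divide_le_eq mult.commute mult.left_commute)
qed

text \<open>An offset beyond \<open>X\<close> needs a jump of the velocity larger than the one at the corner, which is
\<open>X + p\<close>. But the flights before and after are by at most one half turn, hence their velocities
exceed \<open>p\<close> by at most about \<open>\<eta> X / 8\<close>, and the jump is at most about \<open>2 p + \<eta> X / 4\<close>. This
contradicts the gap of about \<open>\<eta> X\<close> between \<open>p\<close> and \<open>X\<close>.\<close>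
lemma offset_le_X:
  assumes n: "\<bar>n\<bar> \<le> 1" and n': "\<bar>n'\<bar> \<le> 1"
    and box: "\<bar>x0\<bar> \<le> 3 * X / 2" "\<bar>x\<bar> \<le> 3 * X / 2" "\<bar>x1\<bar> \<le> 3 * X / 2" "\<bar>q\<bar> \<le> X" "\<bar>q1\<bar> \<le> X"
    and "flies \<eta> n x0 x q" "reflects \<eta> x q q1" "flies \<eta> n' x x1 q1"
  shows "x \<le> X"
proof (rule ccontr)
  assume "\<not> x \<le> X"
  then have x: "X < x"
    by simp
  have speed: "u * (2 * rho_min) \<le> \<eta> / 2 * (pi + X / 2)"
    if u: "u * D = \<eta> / 2 * y" "2 * rho_min \<le> D" "y \<le> pi + X / 2" for u D y
  proof (cases "u \<ge> 0")
    case True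
    then have "u * (2 * rho_min) \<le> u * D"
      using that by (intro mult_left_mono) auto
    also have "\<dots> \<le> \<eta> / 2 * (pi + X / 2)"
      unfolding u(1) using u(3) eta_pos by (intro mult_left_mono) auto
    finally show ?thesis .
  next
    case False
    then have "u * (2 * rho_min) \<le> 0"
      using rho_min_ge by (intro mult_nonpos_nonneg) auto
    also have "\<dots> \<le> \<eta> / 2 * (pi + X / 2)"
      using eta_pos X_pos by simp
    finally show ?thesis .
  qed
  have pin: "pi * of_int n' \<le> pi" "- (pi * of_int n) \<le> pi"
    using n n' mult_left_mono[of "real_of_int n'" 1 pi] mult_left_mono[of "- real_of_int n" 1 pi] by auto
  \<comment> \<open>since \<open>X < x \<le> 3 X / 2\<close>, leaving and reaching \<open>x\<close> both cost at most \<open>X / 2\<close> of extra angle\<close>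
  have shift: "pi * of_int n' + x1 - x \<le> pi + X / 2" "- (pi * of_int n + x - x0) \<le> pi + X / 2"
    using pin box x by linarith+
  have q1: "q1 * (2 * rho_min) \<le> \<eta> / 2 * (pi + X / 2)"
  proof (rule speed)
    show "q1 * (rho \<eta> x q1 + rho \<eta> x1 q1) = \<eta> / 2 * (pi * of_int n' + x1 - x)"
      using assms(10) by (simp add: flies_def)
  qed (use rho_bounds(1)[OF box(2,5)] rho_bounds(1)[OF box(3,5)] shift in linarith)+
  have q: "- q * (2 * rho_min) \<le> \<eta> / 2 * (pi + X / 2)"
  proof (rule speed)
    show "- q * (rho \<eta> x0 q + rho \<eta> x q) = \<eta> / 2 * (- (pi * of_int n + x - x0))"
      using assms(8) unfolding flies_def by (simp add: algebra_simps)
  qed (use rho_bounds(1)[OF box(1,4)] rho_bounds(1)[OF box(2,4)] shift in linarith)+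
  have "sin X \<le> sin x"
    using x box X_small X_pos pi_ge_two by (intro sin_monotone_2pi_le) auto
  then have "sin X * (2 * rho_min) \<le> sin x * (rho \<eta> x q + rho \<eta> x q1)"
    using rho_bounds(1)[OF box(2,4)] rho_bounds(1)[OF box(2,5)] sin_X_bounds rho_min_ge
    by (intro mult_mono) auto
  also have "\<dots> = q1 - q"
    using assms(9) by (simp add: reflects_def)
  finally have "sin X * (2 * rho_min) * (2 * rho_min) \<le> (q1 - q) * (2 * rho_min)"
    using rho_min_ge by (intro mult_right_mono) auto
  also have "\<dots> \<le> \<eta> * (pi + X / 2)"
    using q q1 by (simp add: algebra_simps)
  also have "\<dots> \<le> 4 * (p * rho_max) + \<eta> * X / 2"
    using corner_flight_bounds(2) by (simp add: algebra_simps)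
  finally have main: "rho_min * (2 * rho_min * sin X) \<le> 2 * (p * rho_max) + \<eta> * X / 4"
    by (simp add: algebra_simps)
  define e where "e = \<eta> * X"
  have e: "0 < e"
    unfolding e_def using eta_pos X_pos by simp
  have spread: "(rho_max - rho_min) * t \<le> 11 / 1000 * \<eta> * X" if "0 \<le> t" "t \<le> X" for t
    using that rho_spread_le rho_min_le_max eta_pos by (intro mult_mono) auto
  \<comment> \<open>the reflection at the corner bounds \<open>sin X\<close> from below\<close>
  have cube: "(sin X)\<^sup>2 * (X - p) \<le> X\<^sup>2 * X"
    using p_bounds sin_X_bounds by (intro mult_mono power_mono) auto
  also have "X\<^sup>2 * X \<le> \<eta> / 100 * X"
    using X_square_small X_pos by (intro mult_right_mono) auto
  finally have cube: "(sin X)\<^sup>2 * (X - p) \<le> e / 100"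
    by (simp add: e_def)
  have "X + p - (sin X)\<^sup>2 * (X - p) = 2 * rho \<eta> X X * sin X"
    using corner_reflection by (simp add: algebra_simps cos_squared_eq)
  also have "\<dots> \<le> 2 * rho_max * sin X"
    using rho_bounds(2)[of X X] sin_X_bounds X_pos by (intro mult_right_mono mult_left_mono) auto
  also have "\<dots> \<le> 2 * rho_min * sin X + 2 * (11 / 1000 * e)"
    using spread[of "sin X"] sin_X_bounds by (simp add: algebra_simps e_def)
  finally have left: "X + p - e / 100 - 22 / 1000 * e \<le> 2 * rho_min * sin X"
    using cube by simp
  have "rho_min * (X + p - e / 100 - 22 / 1000 * e) \<le> rho_min * (2 * rho_min * sin X)"
    using left rho_min_ge by (intro mult_left_mono) auto
  also note main
  also have "p * rho_max \<le> p * rho_min + 11 / 1000 * e"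
    using spread[of p] p_bounds by (simp add: algebra_simps e_def)
  finally have "rho_min * (X - p - 32 / 1000 * e) \<le> 272 / 1000 * e"
    by (simp add: algebra_simps e_def)
  moreover have "99 / 100 * (948 / 1000 * e) \<le> rho_min * (X - p - 32 / 1000 * e)"
  proof (intro mult_mono)
    show "948 / 1000 * e \<le> X - p - 32 / 1000 * e"
      using corner_gap(1) unfolding e_def by linarith
  qed (use rho_min_ge e in auto)
  ultimately show False
    using e by linarith
qed

lemma rho_minus [simp]: "rho \<eta> (- x) q = rho \<eta> x q" "rho \<eta> x (- q) = rho \<eta> x q"
  by (simp_all add: rho_def)

text \<open>The equations are invariant under the reflection of the angle about a top. It turns the upper
bound for offsets into a lower one.\<close>
lemma flies_minus: "flies \<eta> (- n) (- x) (- x1) (- q) \<longleftrightarrow> flies \<eta> n x x1 q"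
proof -
  have "\<eta> / 2 * (pi * of_int (- n) + - x1 - - x) = - (\<eta> / 2 * (pi * of_int n + x1 - x))"
    by (simp add: algebra_simps)
  then show ?thesis
    unfolding flies_def rho_minus mult_minus_left by (simp only: neg_equal_iff_equal)
qed

lemma reflects_minus: "reflects \<eta> (- x) (- q) (- q1) \<longleftrightarrow> reflects \<eta> x q q1"
  by (auto simp: reflects_def)

lemma abs_offset_le_X:
  assumes n: "\<bar>n\<bar> \<le> 1" and n': "\<bar>n'\<bar> \<le> 1"
    and box: "\<bar>x0\<bar> \<le> 3 * X / 2" "\<bar>x\<bar> \<le> 3 * X / 2" "\<bar>x1\<bar> \<le> 3 * X / 2" "\<bar>q\<bar> \<le> X" "\<bar>q1\<bar> \<le> X"
    and "flies \<eta> n x0 x q" "reflects \<eta> x q q1" "flies \<eta> n' x x1 q1"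
  shows "\<bar>x\<bar> \<le> X"
proof -
  have "x \<le> X"
    by (rule offset_le_X[of n n' x0 x x1 q q1]) (fact assms)+
  moreover have "- x \<le> X"
    by (rule offset_le_X[of "- n" "- n'" "- x0" "- x" "- x1" "- q" "- q1"])
      (simp_all only: abs_minus_cancel flies_minus reflects_minus assms)
  ultimately show ?thesis
    by simp
qed

text \<open>Two half turns need a speed of about \<open>2 p\<close>, and the domain only
allows \<open>X\<close>, which is close to \<open>p\<close>.\<close>
lemma half_turns_le_1:
  assumes "\<bar>x\<bar> \<le> X" "\<bar>x1\<bar> \<le> X" "\<bar>q\<bar> \<le> X" "flies \<eta> n x x1 q"
  shows "\<bar>n\<bar> \<le> 1"
proof (rule ccontr)
  assume "\<not> \<bar>n\<bar> \<le> 1"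
  then have "2 \<le> \<bar>real_of_int n\<bar>"
    by linarith
  then have "pi * 2 \<le> \<bar>pi * of_int n\<bar>"
    by (simp add: abs_mult)
  then have "2 * pi \<le> \<bar>(pi * of_int n + x1 - x) + (x - x1)\<bar>"
    by simp
  also have "\<dots> \<le> \<bar>pi * of_int n + x1 - x\<bar> + \<bar>x - x1\<bar>"
    by (rule abs_triangle_ineq)
  also have "\<bar>x - x1\<bar> \<le> 2 * X"
    using assms(1,2) by (simp add: abs_le_iff)
  finally have "2 * pi - 2 * X \<le> \<bar>pi * of_int n + x1 - x\<bar>"
    by simp
  then have "\<eta> / 2 * (2 * pi - 2 * X) \<le> \<eta> / 2 * \<bar>pi * of_int n + x1 - x\<bar>"
    using eta_pos by (intro mult_left_mono) auto
  also have "\<dots> = \<bar>\<eta> / 2 * (pi * of_int n + x1 - x)\<bar>"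
    using eta_pos by (simp add: abs_mult)
  also have "\<dots> = \<bar>q\<bar> * \<bar>rho \<eta> x q + rho \<eta> x1 q\<bar>"
    using assms(4) by (simp only: flies_def abs_mult[symmetric])
  also have "\<dots> \<le> X * 2"
  proof -
    have "0 \<le> rho \<eta> z q \<and> rho \<eta> z q \<le> 1" if "\<bar>z\<bar> \<le> X" for z
      using that rho_ge[of z q] rho_le[of z q] assms(3) X_pos by simp
    from this[OF assms(1)] this[OF assms(2)] show ?thesis
      using assms(3) X_pos by (intro mult_mono) auto
  qed
  finally have "pi * \<eta> \<le> 2 * X + \<eta> * X"
    by (simp add: algebra_simps)
  moreover have "96 / 100 * X * (99 / 100) \<le> p * rho_min"
    using p_bounds rho_min_ge X_pos by (intro mult_mono) auto
  moreover have "\<eta> * X \<le> 1 / 100 * X"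
    using eta_small X_pos by (intro mult_right_mono) auto
  ultimately show False
    using corner_flight_bounds(1) X_pos by linarith
qed

text \<open>Within the domain the angle of a flight is, up to small terms, a function of its velocity, so
the symbol of a flight can be read off from the state in which it ends.\<close>
lemma flight_determines_half_turns:
  assumes "\<bar>x\<bar> \<le> X" "\<bar>x1\<bar> \<le> X" "\<bar>y\<bar> \<le> X" "\<bar>y1\<bar> \<le> X" "\<bar>q\<bar> \<le> X" 
    "flies \<eta> n x x1 q" "flies \<eta> m y y1 q"
  shows "n = m"
proof (rule ccontr)
  assume "n \<noteq> m"
  then have "1 \<le> \<bar>real_of_int n - real_of_int m\<bar>"
    by linarith
  then have "pi * 1 \<le> \<bar>pi * (real_of_int n - real_of_int m)\<bar>"
    by (simp add: abs_mult)
  also have "pi * (real_of_int n - real_of_int m) =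
      ((pi * of_int n + x1 - x) - (pi * of_int m + y1 - y)) + ((x - x1) + (y1 - y))"
    by (simp add: algebra_simps)
  also have "\<bar>\<dots>\<bar> \<le> \<bar>(pi * of_int n + x1 - x) - (pi * of_int m + y1 - y)\<bar> + \<bar>(x - x1) + (y1 - y)\<bar>"
    by (rule abs_triangle_ineq)
  also have "\<bar>(x - x1) + (y1 - y)\<bar> \<le> 4 * X"
    using assms(1-4) by (simp add: abs_le_iff)
  finally have "pi - 4 * X \<le> \<bar>(pi * of_int n + x1 - x) - (pi * of_int m + y1 - y)\<bar>"
    by simp
  moreover have pi: "pi \<ge> 31 / 10"
    using pi_approx by simp
  ultimately have "\<eta> / 2 * 3 \<le> \<eta> / 2 * \<bar>(pi * of_int n + x1 - x) - (pi * of_int m + y1 - y)\<bar>"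
    using eta_pos X_small pi by (intro mult_left_mono) linarith+
  also have "\<dots> = \<bar>\<eta> / 2 * ((pi * of_int n + x1 - x) - (pi * of_int m + y1 - y))\<bar>"
    using eta_pos by (simp add: abs_mult)
  also have "\<dots> = \<bar>q * (rho \<eta> x q + rho \<eta> x1 q) - q * (rho \<eta> y q + rho \<eta> y1 q)\<bar>"
    using assms(6,7) by (simp only: flies_def right_diff_distrib[of _ "pi * of_int n + x1 - x"])
  also have "\<dots> = \<bar>q * (rho \<eta> x q + rho \<eta> x1 q - rho \<eta> y q - rho \<eta> y1 q)\<bar>"
    by (simp only: right_diff_distrib diff_diff_eq)
  also have "\<dots> \<le> X * (2 * (11 / 1000 * \<eta>))"
  proof -
    have "\<bar>rho \<eta> x q + rho \<eta> x1 q - rho \<eta> y q - rho \<eta> y1 q\<bar> \<le> 2 * (rho_max - rho_min)"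
    proof -
      have b: "\<bar>z\<bar> \<le> X \<Longrightarrow> rho_min \<le> rho \<eta> z q \<and> rho \<eta> z q \<le> rho_max" for z
        using rho_bounds[of z q] assms(5) X_pos by simp
      show ?thesis
        using b[OF assms(1)] b[OF assms(2)] b[OF assms(3)] b[OF assms(4)] by (simp add: abs_le_iff)
    qed
    then show ?thesis
      unfolding abs_mult using assms(5) rho_spread_le by (intro mult_mono) auto
  qed
  also have "\<dots> \<le> 1 / 100 * (2 * (11 / 1000 * \<eta>))"
    using X_small eta_pos by (intro mult_right_mono) auto
  finally show False
    using eta_pos by simp
qed

end

section \<open>One orbit for each sequence of half turns\<close>
fun move :: "coin_symbol \<Rightarrow> int" where
  "move L1 = - 1" | "move L2 = 0" | "move L3 = 1"
| "move R1 = - 1" | "move R2 = 0" | "move R3 = 1"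

lemma abs_move_le: "\<bar>move a\<bar> \<le> 1"
  by (cases a) auto

lemma abs_sum_diff_le:
  fixes a b a' b' :: real
  shows "\<bar>a - a'\<bar> \<le> e \<Longrightarrow> \<bar>b - b'\<bar> \<le> e' \<Longrightarrow> \<bar>(a + b) - (a' + b')\<bar> \<le> e + e'"
  by linarith

text \<open>The equations of motion solved for the state \<open>v\<close> of one collision, given the previous one \<open>u\<close>
and the next one \<open>w\<close>. The symbol \<open>a\<close> belongs to the flight that ends in \<open>v\<close>. A state is the
pair of an offset and four times a velocity: an offset is about half the difference of two
velocities, hence would move as much as they do, and the factor four makes the map a contraction
for the Euclidean distance.\<close>
definition update ::
  "real \<Rightarrow> coin_symbol \<Rightarrow> real \<times> real \<Rightarrow> real \<times> real \<Rightarrow> real \<times> real \<Rightarrow> real \<times> real" where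
  "update \<eta> a u v w =
    (fst v - sin (fst v) +
       (snd w / 4 - snd v / 4) / (rho \<eta> (fst v) (snd v / 4) + rho \<eta> (fst v) (snd w / 4)),
     4 * (\<eta> / 2 * (pi * of_int (move a) + fst v - fst u) /
       (rho \<eta> (fst u) (snd v / 4) + rho \<eta> (fst v) (snd v / 4))))"

context small_parameters
begin

definition state_box :: "(real \<times> real) set" where
  "state_box = {- (3 * X / 2)..3 * X / 2} \<times> {- (4 * X)..4 * X}"

lemma state_box_iff: "z \<in> state_box \<longleftrightarrow> \<bar>fst z\<bar> \<le> 3 * X / 2 \<and> \<bar>snd z / 4\<bar> \<le> X"
  by (auto simp: state_box_def mem_Times_iff)

lemma flight_data:
  assumes "u \<in> state_box" "v \<in> state_box"
  shows "\<bar>pi * of_int (move a) + fst v - fst u\<bar> \<le> pi + 3 * X"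
    "2 * rho_min \<le> rho \<eta> (fst u) (snd v / 4) + rho \<eta> (fst v) (snd v / 4)"
proof -
  have "\<bar>pi * of_int (move a)\<bar> \<le> pi"
    using abs_move_le[of a] by (cases a) (auto simp: abs_mult)
  then show "\<bar>pi * of_int (move a) + fst v - fst u\<bar> \<le> pi + 3 * X"
    using assms unfolding state_box_iff by linarith
  show "2 * rho_min \<le> rho \<eta> (fst u) (snd v / 4) + rho \<eta> (fst v) (snd v / 4)"
    using assms rho_bounds(1)[of "fst u" "snd v / 4"] rho_bounds(1)[of "fst v" "snd v / 4"]
    unfolding state_box_iff by linarith
qed

lemma update_in_state_box:
  assumes "u \<in> state_box" "v \<in> state_box" "w \<in> state_box"
  shows "update \<eta> a u v w \<in> state_box"
proof -
  define x q q1 where "x = fst v" and "q = snd v / 4" and "q1 = snd w / 4"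
  have b: "\<bar>x\<bar> \<le> 3 * X / 2" "\<bar>q\<bar> \<le> X" "\<bar>q1\<bar> \<le> X"
    using assms unfolding state_box_iff x_def q_def q1_def by auto
  define D where "D = rho \<eta> x q + rho \<eta> x q1"
  have D: "198 / 100 \<le> D"
    unfolding D_def using rho_ge[OF b(1,2)] rho_ge[OF b(1,3)] by simp
  have "\<bar>(x - sin x) - (0 - sin 0)\<bar> \<le> \<bar>x - 0\<bar> / 1000"
    using b(1) X_small by (intro self_minus_sin_lipschitz) auto
  then have "\<bar>x - sin x\<bar> \<le> 3 * X / 2 / 1000"
    using b(1) by simp
  moreover have "\<bar>(q1 - q) / D\<bar> \<le> 2 * X / (198 / 100)"
    unfolding abs_divide using b D X_pos by (intro frac_le) auto
  ultimately have "\<bar>x - sin x\<bar> + \<bar>(q1 - q) / D\<bar> \<le> 3 * X / 2"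
    using X_pos by simp
  then have "\<bar>x - sin x + (q1 - q) / D\<bar> \<le> 3 * X / 2"
    by (rule order_trans[OF abs_triangle_ineq])
  moreover define t where "t = \<eta> / 2 * (pi * of_int (move a) + fst v - fst u) /
       (rho \<eta> (fst u) (snd v / 4) + rho \<eta> (fst v) (snd v / 4))"
  have "\<bar>t\<bar> \<le> X"
    unfolding t_def using flight_data[OF assms(1,2)] by (rule flight_speed_le)
  moreover have "update \<eta> a u v w = (x - sin x + (q1 - q) / D, 4 * t)"
    by (simp only: update_def x_def q_def q1_def D_def t_def)
  ultimately show ?thesis
    unfolding state_box_iff by simp
qed

text \<open>The velocity only changes by the order of \<open>\<eta>\<close>, because a flight by a given number of half turns
has its angle known up to offsets. The offset changes like the velocities, that is by a fraction
of the rescaled distance; everything else is small.\<close>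
lemma update_contracts:
  assumes box: "u \<in> state_box" "v \<in> state_box" "w \<in> state_box"
      "u' \<in> state_box" "v' \<in> state_box" "w' \<in> state_box"
    and d: "dist u u' \<le> d" "dist v v' \<le> d" "dist w w' \<le> d"
  shows "dist (update \<eta> a u v w) (update \<eta> a u' v' w') \<le> 3 / 4 * d"
proof -
  have comp: "\<bar>fst z - fst z'\<bar> \<le> d" "\<bar>snd z / 4 - snd z' / 4\<bar> \<le> d / 4"
    if "dist z z' \<le> d" for z z' :: "real \<times> real"
    using that dist_fst_le[of z z'] dist_snd_le[of z z'] unfolding dist_real_def by linarith+
  define x0 x q q1 x0' x' q' q1' where defs: "x0 = fst u" "x = fst v" "q = snd v / 4" "q1 = snd w / 4"
    "x0' = fst u'" "x' = fst v'" "q' = snd v' / 4" "q1' = snd w' / 4"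
  have b: "\<bar>x0\<bar> \<le> 3 * X / 2" "\<bar>x\<bar> \<le> 3 * X / 2" "\<bar>q\<bar> \<le> X" "\<bar>q1\<bar> \<le> X"
    and b': "\<bar>x0'\<bar> \<le> 3 * X / 2" "\<bar>x'\<bar> \<le> 3 * X / 2" "\<bar>q'\<bar> \<le> X" "\<bar>q1'\<bar> \<le> X"
    using box unfolding state_box_iff defs by auto
  have diff: "\<bar>x0 - x0'\<bar> \<le> d" "\<bar>x - x'\<bar> \<le> d" "\<bar>q - q'\<bar> \<le> d / 4" "\<bar>q1 - q1'\<bar> \<le> d / 4"
    unfolding defs using comp d by auto
  have d_nonneg: "0 \<le> d"
    using diff(1) by linarith
  define D D' where D: "D = rho \<eta> x q + rho \<eta> x q1" and D': "D' = rho \<eta> x' q' + rho \<eta> x' q1'"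
  define C C' where C: "C = rho \<eta> x0 q + rho \<eta> x q" and C': "C' = rho \<eta> x0' q' + rho \<eta> x' q'"
  define N N' where N: "N = \<eta> / 2 * (pi * of_int (move a) + x - x0)"
    and N': "N' = \<eta> / 2 * (pi * of_int (move a) + x' - x0')"
  have ge1: "D \<ge> 1" "D' \<ge> 1" "C \<ge> 1" "C' \<ge> 1"
    unfolding D D' C C' using rho_ge[OF b(2,3)] rho_ge[OF b(2,4)] rho_ge[OF b'(2,3)] rho_ge[OF b'(2,4)]
      rho_ge[OF b(1,3)] rho_ge[OF b'(1,3)] by simp_all
  have rho_diff: "\<bar>rho \<eta> y r - rho \<eta> y' r'\<bar> \<le> d / 40"
    if "\<bar>y\<bar> \<le> 3 * X / 2" "\<bar>r\<bar> \<le> X" "\<bar>y'\<bar> \<le> 3 * X / 2" "\<bar>r'\<bar> \<le> X"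
      "\<bar>y - y'\<bar> \<le> d" "\<bar>r - r'\<bar> \<le> d / 4" for y r y' r'
    using rho_lipschitz[OF that(1-4)] that(5,6) by simp
  have D_diff: "\<bar>D - D'\<bar> \<le> d / 20"
    unfolding D D' using abs_sum_diff_le[OF rho_diff[OF b(2,3) b'(2,3) diff(2,3)] rho_diff[OF b(2,4) b'(2,4) diff(2,4)]]
    by simp
  have C_diff: "\<bar>C - C'\<bar> \<le> d / 20"
    unfolding C C' using abs_sum_diff_le[OF rho_diff[OF b(1,3) b'(1,3) diff(1,3)] rho_diff[OF b(2,3) b'(2,3) diff(2,3)]]
    by simp
  have "\<bar>(x - sin x) - (x' - sin x')\<bar> \<le> \<bar>x - x'\<bar> / 1000"
    using b(2) b'(2) X_small by (intro self_minus_sin_lipschitz) auto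
  then have 1: "\<bar>(x - sin x) - (x' - sin x')\<bar> \<le> d / 1000"
    using diff(2) by simp
  have "\<bar>q1' - q'\<bar> \<le> 2 / 100"
    using b' X_small by linarith
  then have "\<bar>q1' - q'\<bar> * \<bar>D - D'\<bar> \<le> 2 / 100 * (d / 20)"
    using D_diff by (intro mult_mono) auto
  moreover have "\<bar>(q1 - q) / D - (q1' - q') / D'\<bar> \<le> \<bar>(q1 - q) - (q1' - q')\<bar> + \<bar>q1' - q'\<bar> * \<bar>D - D'\<bar>"
    by (rule quotient_diff_le[OF ge1(1,2)])
  moreover have "\<bar>(q1 - q) - (q1' - q')\<bar> \<le> d / 2"
    using diff(3,4) by linarith
  ultimately have 2: "\<bar>(q1 - q) / D - (q1' - q') / D'\<bar> \<le> d / 2 + d / 1000"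
    by simp
  have offset: "\<bar>(x - sin x + (q1 - q) / D) - (x' - sin x' + (q1' - q') / D')\<bar> \<le> 6 / 10 * d"
    using d_nonneg by (intro order_trans[OF abs_sum_diff_le[OF 1 2]]) simp
  have "\<bar>N'\<bar> \<le> \<eta> / 2 * (pi + 3 * X)"
    unfolding N' abs_mult using flight_data(1)[OF box(4,5), of a] eta_pos unfolding defs
    by (intro mult_mono) auto
  also have "\<dots> \<le> 1 / 100 / 2 * (4 + 3 / 100)"
    using eta_small eta_pos X_small X_pos pi_less_4 by (intro mult_mono) auto
  finally have "\<bar>N'\<bar> * \<bar>C - C'\<bar> \<le> 3 / 100 * (d / 20)"
    using C_diff by (intro mult_mono) auto
  moreover have "\<bar>N - N'\<bar> \<le> d / 100"
  proof -
    have "\<bar>N - N'\<bar> = \<eta> / 2 * \<bar>(x - x') - (x0 - x0')\<bar>"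
      unfolding N N' right_diff_distrib[symmetric] abs_mult using eta_pos by (simp add: algebra_simps)
    also have "\<dots> \<le> 1 / 100 / 2 * (2 * d)"
      using eta_small eta_pos diff by (intro mult_mono) auto
    finally show ?thesis
      by simp
  qed
  moreover have "\<bar>N / C - N' / C'\<bar> \<le> \<bar>N - N'\<bar> + \<bar>N'\<bar> * \<bar>C - C'\<bar>"
    by (rule quotient_diff_le[OF ge1(3,4)])
  ultimately have speed: "\<bar>4 * (N / C) - 4 * (N' / C')\<bar> \<le> 1 / 10 * d"
    using d_nonneg unfolding right_diff_distrib[symmetric] abs_mult by simp
  have "update \<eta> a u v w = (x - sin x + (q1 - q) / D, 4 * (N / C))"
    "update \<eta> a u' v' w' = (x' - sin x' + (q1' - q') / D', 4 * (N' / C'))"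
    by (simp_all add: update_def defs D D' C C' N N')
  moreover have "dist (A, B) (A', B') \<le> 3 / 4 * d"
    if "\<bar>A - A'\<bar> \<le> 6 / 10 * d" "\<bar>B - B'\<bar> \<le> 1 / 10 * d" for A A' B B' :: real
    using norm_Pair_le[of "A - A'" "B - B'"] that d_nonneg by (simp add: dist_norm)
  ultimately show ?thesis
    using offset speed by simp
qed

sublocale chain: contracting_chain "update \<eta>" state_box "3 / 4"
proof
  show "closed state_box" "bounded state_box"
    unfolding state_box_def by (auto intro: closed_Times bounded_Times)
  show "state_box \<noteq> {}"
    using X_pos by (auto simp: state_box_def)
  show "update \<eta> s u v w \<in> state_box" if "u \<in> state_box" "v \<in> state_box" "w \<in> state_box" for s u v w
    using that by (rule update_in_state_box)
  show "dist (update \<eta> s u v w) (update \<eta> s u' v' w') \<le> 3 / 4 * d"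
    if "u \<in> state_box" "v \<in> state_box" "w \<in> state_box" "u' \<in> state_box" "v' \<in> state_box" "w' \<in> state_box"
      "dist u u' \<le> d" "dist v v' \<le> d" "dist w w' \<le> d" for s u v w u' v' w' d
    using that by (rule update_contracts)
qed auto

lemma update_fixed_iff:
  assumes "u \<in> state_box" "v \<in> state_box" "w \<in> state_box"
  shows "v = update \<eta> a u v w \<longleftrightarrow>
    flies \<eta> (move a) (fst u) (fst v) (snd v / 4) \<and> reflects \<eta> (fst v) (snd v / 4) (snd w / 4)"
proof -
  define D where "D = rho \<eta> (fst v) (snd v / 4) + rho \<eta> (fst v) (snd w / 4)"
  define C where "C = rho \<eta> (fst u) (snd v / 4) + rho \<eta> (fst v) (snd v / 4)"
  have pos: "D > 0" "C > 0"
    unfolding D_def C_def using assms rho_ge[of "fst v" "snd v / 4"] rho_ge[of "fst v" "snd w / 4"]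
      rho_ge[of "fst u" "snd v / 4"] unfolding state_box_iff by auto
  have "fst v = fst v - sin (fst v) + (snd w / 4 - snd v / 4) / D \<longleftrightarrow>
      reflects \<eta> (fst v) (snd v / 4) (snd w / 4)"
    unfolding reflects_def D_def[symmetric] using pos by (auto simp: field_simps)
  moreover have "snd v = 4 * (\<eta> / 2 * (pi * of_int (move a) + fst v - fst u) / C) \<longleftrightarrow>
      flies \<eta> (move a) (fst u) (fst v) (snd v / 4)"
    unfolding flies_def C_def[symmetric] using pos by (auto simp: field_simps)
  ultimately show ?thesis
    unfolding update_def D_def C_def prod_eq_iff by auto
qed

text \<open>Orbits that stay within the offset and velocity bounds of the domain and make the half turns
prescribed by the symbols.\<close>
definition shadows :: "(int \<Rightarrow> coin_symbol) \<Rightarrow> (int \<Rightarrow> real) \<Rightarrow> (int \<Rightarrow> real) \<Rightarrow> bool" where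
  "shadows s x q \<longleftrightarrow> (\<forall>i. \<bar>x i\<bar> \<le> X \<and> \<bar>q i\<bar> \<le> X \<and>
     flies \<eta> (move (s i)) (x (i - 1)) (x i) (q i) \<and> reflects \<eta> (x i) (q i) (q (i + 1)))"

text \<open>The contraction first finds a solution with offsets up to \<open>3 X / 2\<close>. Applied to arbitrary states
it may produce offsets beyond \<open>X\<close>, because velocities of opposite extreme signs give an offset of
about \<open>X\<close>. In a solution the velocities satisfy the flight equation too, and this gives the bound
\<open>X\<close>.\<close>
lemma shadows_exists: "\<exists>x q. shadows s x q"
proof -
  obtain z where z: "chain.solves s z"
    using chain.solution_exists by blast
  define x q where "x = (\<lambda>i. fst (z i))" and "q = (\<lambda>i. snd (z i) / 4)"
  have box: "z i \<in> state_box" for i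
    using chain.solvesD(1)[OF z] .
  then have xq: "\<bar>x i\<bar> \<le> 3 * X / 2" "\<bar>q i\<bar> \<le> X" for i
    unfolding state_box_iff x_def q_def by auto
  have eqs: "flies \<eta> (move (s i)) (x (i - 1)) (x i) (q i) \<and> reflects \<eta> (x i) (q i) (q (i + 1))" for i
    unfolding x_def q_def using update_fixed_iff[OF box box box] chain.solvesD(2)[OF z, of i] by metis
  have "\<bar>x i\<bar> \<le> X" for i
    using eqs[of i] eqs[of "i + 1"]
    by (intro abs_offset_le_X[of "move (s i)" "move (s (i + 1))" "x (i - 1)" "x i" "x (i + 1)" "q i" "q (i + 1)"]
        abs_move_le xq) auto
  then show ?thesis
    unfolding shadows_def using xq eqs by blast
qed

lemma shadows_solves:
  assumes "shadows s x q"
  shows "chain.solves s (\<lambda>i. (x i, 4 * q i))"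
proof -
  have box: "(x i, 4 * q i) \<in> state_box" for i
  proof -
    have "\<bar>x i\<bar> \<le> X" "\<bar>q i\<bar> \<le> X"
      using assms unfolding shadows_def by blast+
    then show ?thesis
      using X_pos unfolding state_box_iff by simp
  qed
  have "(x i, 4 * q i) = update \<eta> (s i) (x (i - 1), 4 * q (i - 1)) (x i, 4 * q i) (x (i + 1), 4 * q (i + 1))" for i
    using assms by (intro iffD2[OF update_fixed_iff[OF box box box]]) (simp add: shadows_def)
  with box show ?thesis
    unfolding chain.solves_def by blast
qed

lemma shadows_unique:
  assumes "shadows s x q" "shadows s x' q'"
  shows "x = x' \<and> q = q'"
proof -
  have "(\<lambda>i. (x i, 4 * q i)) = (\<lambda>i. (x' i, 4 * q' i))"
    using chain.solution_unique[OF shadows_solves[OF assms(1)] shadows_solves[OF assms(2)]] .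
  then have "(x i, 4 * q i) = (x' i, 4 * q' i)" for i
    by (rule fun_cong)
  then show ?thesis
    by (simp add: fun_eq_iff)
qed

lemma shadows_close:
  assumes "shadows s x q" "shadows s' x' q'" "\<forall>i. \<bar>i - j\<bar> < int m \<longrightarrow> s i = s' i"
  shows "\<bar>x j - x' j\<bar> \<le> (3 / 4) ^ m * diameter state_box"
    and "\<bar>q j - q' j\<bar> \<le> (3 / 4) ^ m * diameter state_box"
proof -
  define R where "R = (3 / 4) ^ m * diameter state_box"
  have d: "dist (x j, 4 * q j) (x' j, 4 * q' j) \<le> R"
    unfolding R_def
    using chain.solution_depends_locally_on_symbols[OF shadows_solves[OF assms(1)] shadows_solves[OF assms(2)] assms(3)] .
  have "\<bar>x j - x' j\<bar> \<le> R"
    using order_trans[OF dist_fst_le d] unfolding fst_conv dist_real_def .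
  moreover have "\<bar>4 * q j - 4 * q' j\<bar> \<le> R"
    using order_trans[OF dist_snd_le d] unfolding snd_conv dist_real_def .
  ultimately show "\<bar>x j - x' j\<bar> \<le> (3 / 4) ^ m * diameter state_box"
    and "\<bar>q j - q' j\<bar> \<le> (3 / 4) ^ m * diameter state_box"
    unfolding R_def[symmetric] by linarith+
qed

end

section \<open>Collisions near the tops of the bumps\<close>

definition top_at :: "int \<Rightarrow> real \<Rightarrow> real" where
  "top_at m x = pi / 2 + pi * of_int m + x"

lemma sin_top_at: "sin (top_at m x) = (if even m then cos x else - cos x)"
  and cos_top_at: "cos (top_at m x) = (if even m then - sin x else sin x)"
  by (simp_all add: top_at_def sin_add cos_add cos_npi_int sin_npi_int)

lemma abs_sin_top_at: "\<bar>sin (top_at m x)\<bar> = \<bar>cos x\<bar>"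
  by (simp add: sin_top_at)

lemma boundary_slope_top_at: "cos x > 0 \<Longrightarrow> boundary_slope (top_at m x) = - sin x"
  by (simp add: boundary_slope_def sin_top_at cos_top_at)

text \<open>A vector and its mirror image are the only points of a line in direction \<open>n\<close> with their norm.\<close>
lemma mirror_eqI:
  fixes v n :: "'a::real_inner"
  assumes "c \<noteq> 0" "n \<noteq> 0" "norm (v + c *\<^sub>R n) = norm v"
  shows "mirror n v = v + c *\<^sub>R n"
proof -
  have "(v + c *\<^sub>R n) \<bullet> (v + c *\<^sub>R n) = v \<bullet> v"
    using assms(3) by (simp add: dot_square_norm)
  then have "c * (2 * (v \<bullet> n) + c * (n \<bullet> n)) = 0"
    by (simp add: inner_add inner_commute algebra_simps)
  then have "c * (n \<bullet> n) = - (2 * (v \<bullet> n))"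
    using assms(1) by (simp add: mult_eq_0_iff)
  then have "c = - (2 * (v \<bullet> n) / (n \<bullet> n))"
    using assms(2) by (metis inner_eq_zero_iff minus_divide_left nonzero_mult_div_cancel_right)
  then show ?thesis
    by (simp add: mirror_def)
qed

lemma mirror_mirror: "mirror n (mirror n v) = v" for v n :: "'a::real_inner"
proof (cases "n = 0")
  case False
  then have "mirror n v \<bullet> n = - (v \<bullet> n)"
    by (simp add: mirror_def inner_diff)
  then show ?thesis
    by (simp add: mirror_def[of n "mirror n v"]) (simp add: mirror_def)
qed (simp add: mirror_def)

text \<open>The boundary has slope at most one, so a point that rises faster than it moves sideways leaves
it.\<close>
lemma abs_sin_less_rise:
  fixes a u w c :: real
  assumes "0 < u" "\<bar>w\<bar> < c"
  shows "\<bar>sin (a + u * w)\<bar> < \<bar>sin a\<bar> + u * c"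
proof -
  have "\<bar>sin (a + u * w) - sin a\<bar> \<le> \<bar>u * w\<bar>"
    using abs_cos_diff_le[of "pi / 2 - (a + u * w)" "pi / 2 - a"]
    by (simp add: cos_diff abs_minus_commute)
  also have "\<dots> < u * c"
    using assms by (simp add: abs_mult)
  finally show ?thesis
    by linarith
qed

lemma vertical_speed_scaled:
  assumes "0 < E" "0 \<le> cos x"
  shows "sqrt (2 * E - 2 * g * \<bar>cos x\<bar> - (sqrt (2 * E) * q)\<^sup>2) = sqrt (2 * E) * rho (g / E) x q"
proof -
  have "2 * E - 2 * g * \<bar>cos x\<bar> - (sqrt (2 * E) * q)\<^sup>2 = 2 * E * (1 - g / E * cos x - q\<^sup>2)"
    using assms by (simp add: power_mult_distrib field_simps)
  then show ?thesis
    by (simp add: rho_def real_sqrt_mult)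
qed

lemma angular_velocity_scaled:
  assumes "0 < E"
  shows "sqrt 2 * k / sqrt E = sqrt (2 * E) * (k / E)"
proof -
  have "sqrt (2 * E) * (k / E) = sqrt 2 * sqrt E * (k / (sqrt E * sqrt E))"
    using assms by (simp add: real_sqrt_mult)
  also have "\<dots> = sqrt 2 * k / sqrt E"
  proof -
    have "a * s * (k / (s * s)) = a * k / s" if "s \<noteq> 0" for a s :: real
      using that by simp
    moreover have "sqrt E \<noteq> 0"
      using assms by simp
    ultimately show ?thesis .
  qed
  finally show ?thesis
    by (rule sym)
qed
locale coin_billiard = small_parameters \<eta> X p for \<eta> X p +
  fixes g E k :: real
  assumes g_pos: "0 < g" and E_pos: "0 < E" and eta_eq: "\<eta> = g / E" and X_eq: "X = k / E"
begin

definition S :: real where "S = sqrt (2 * E)"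

lemma S_pos: "0 < S" and S_sq: "S\<^sup>2 = 2 * E"
  using E_pos by (simp_all add: S_def)

definition state :: "int \<Rightarrow> real \<Rightarrow> real \<Rightarrow> real \<times> real" where
  "state m x q = (top_at m x, S * q)"

lemma cos_offset_pos:
  assumes "\<bar>x\<bar> \<le> X"
  shows "9 / 10 \<le> cos x"
proof -
  have "x\<^sup>2 \<le> X\<^sup>2"
    using assms X_pos by (intro abs_le_square_iff[THEN iffD1]) simp
  then show ?thesis
    using one_minus_cos_le[of x] X_square_tiny by simp
qed

lemma sqrt_energy:
  assumes "0 \<le> cos x"
  shows "sqrt (2 * E - 2 * g * \<bar>cos x\<bar> - (S * q)\<^sup>2) = S * rho \<eta> x q"
  using vertical_speed_scaled[OF E_pos assms] by (simp add: S_def eta_eq)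

lemma incoming_velocity_state:
  assumes "\<bar>x\<bar> \<le> X"
  shows "incoming_velocity g E (state m x q) = (S * q, - (S * rho \<eta> x q))"
  using sqrt_energy[of x q] cos_offset_pos[OF assms]
  by (simp add: incoming_velocity_def state_def abs_sin_top_at)

lemma inward_normal_state:
  assumes "\<bar>x\<bar> \<le> X"
  shows "inward_normal (top_at m x) = (sin x, 1)"
  using cos_offset_pos[OF assms] by (simp add: inward_normal_def boundary_slope_top_at)

lemma rho_X_bounds: "\<bar>x\<bar> \<le> X \<Longrightarrow> \<bar>q\<bar> \<le> X \<Longrightarrow> 99 / 100 \<le> rho \<eta> x q \<and> rho \<eta> x q \<le> 1"
  using rho_ge[of x q] rho_le[of x q] X_pos by simp

lemma abs_sin_offset_le: "\<bar>x\<bar> \<le> X \<Longrightarrow> \<bar>sin x\<bar> \<le> 1 / 100"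
  using abs_sin_x_le_abs_x[of x] X_small by simp

lemma state_in_P_down:
  assumes "\<bar>x\<bar> \<le> X" "\<bar>q\<bar> \<le> X"
  shows "state m x q \<in> P_down g E"
proof -
  have "\<bar>q\<bar> * \<bar>sin x\<bar> \<le> 1 / 100 * (1 / 100)"
    using assms(2) X_small abs_sin_offset_le[OF assms(1)] by (intro mult_mono) auto
  then have "q * sin x \<le> rho \<eta> x q"
    using rho_X_bounds[OF assms] abs_ge_self[of "q * sin x"] by (simp add: abs_mult)
  then have "S * (q * sin x) \<le> S * rho \<eta> x q"
    using S_pos by (intro mult_left_mono) auto
  then have "incoming_velocity g E (state m x q) \<bullet> inward_normal (top_at m x) \<le> 0"
    unfolding incoming_velocity_state[OF assms(1)] inward_normal_state[OF assms(1)]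
    by (simp add: inner_prod_def)
  moreover have "0 < 2 * E - 2 * g * \<bar>cos x\<bar> - (S * q)\<^sup>2"
  proof -
    have "0 < S * rho \<eta> x q"
      using rho_X_bounds[OF assms] S_pos by simp
    then show ?thesis
      using sqrt_energy[of x q, symmetric] cos_offset_pos[OF assms(1)] by (simp only: real_sqrt_gt_0_iff)
  qed
  moreover have "sin (top_at m x) \<noteq> 0"
    using cos_offset_pos[OF assms(1)] by (simp add: sin_top_at)
  ultimately show ?thesis
    by (simp add: P_down_def state_def abs_sin_top_at)
qed

text \<open>Near a top the boundary is almost horizontal and the incoming velocity almost vertical. The
reflected velocity therefore points upwards, and its vertical component is the positive root
given by energy conservation.\<close>
lemma outgoing_velocity_state:
  assumes "\<bar>x\<bar> \<le> X" "\<bar>q\<bar> \<le> X"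
  shows "\<exists>q1. reflects \<eta> x q q1 \<and> outgoing_velocity g E (state m x q) = (S * q1, S * rho \<eta> x q1)"
proof -
  define r s where "r = rho \<eta> x q" and "s = sin x"
  have r: "99 / 100 \<le> r" "r \<le> 1" and s: "\<bar>s\<bar> \<le> 1 / 100"
    using rho_X_bounds[OF assms] abs_sin_offset_le[OF assms(1)] by (auto simp: r_def s_def)
  define c where "c = 2 * (r - q * s) / (1 + s\<^sup>2)"
  have s2: "0 \<le> s\<^sup>2" "s\<^sup>2 \<le> (1 / 100)\<^sup>2"
    using s power_mono[OF s, of 2] by simp_all
  have D: "0 < 1 + s\<^sup>2"
    by (rule add_pos_nonneg[OF zero_less_one s2(1)])
  have c: "c * (1 + s\<^sup>2) = 2 * (r - q * s)"
    using D by (simp add: c_def)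
  have "\<bar>q * s\<bar> \<le> 1 / 100 * (1 / 100)"
    unfolding abs_mult using assms(2) X_small s by (intro mult_mono) auto
  then have "r * (1 + s\<^sup>2) < 2 * (r - q * s)"
    using r s2 mult_mono[of r 1 "s\<^sup>2" "(1 / 100)\<^sup>2"] by (simp add: distrib_left power2_eq_square abs_le_iff)
  then have "r < c"
    using D by (simp only: c_def pos_less_divide_eq)
  define q1 where "q1 = q + c * s"
  have "(c - r)\<^sup>2 + q1\<^sup>2 = c * (c * (1 + s\<^sup>2)) + 2 * c * q * s - 2 * c * r + q\<^sup>2 + r\<^sup>2"
    by (simp add: q1_def power2_eq_square algebra_simps)
  also have "\<dots> = q\<^sup>2 + r\<^sup>2"
    unfolding c by (simp add: algebra_simps)
  also have "\<dots> = 1 - \<eta> * cos x"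
    unfolding r_def using rho_squared[of x q] assms X_pos by simp
  finally have "1 - \<eta> * cos x - q1\<^sup>2 = (c - r)\<^sup>2"
    by simp
  then have r1: "rho \<eta> x q1 = c - r"
    using \<open>r < c\<close> by (simp add: rho_def)
  have "reflects \<eta> x q q1"
    unfolding reflects_def r1 r_def[symmetric] by (simp add: q1_def s_def)
  moreover have "outgoing_velocity g E (state m x q) = (S * q1, S * rho \<eta> x q1)"
  proof -
    have n: "(s, 1) \<bullet> (s, 1 :: real) = 1 + s\<^sup>2"
      by (simp add: inner_prod_def power2_eq_square)
    have "2 * ((S * q, - (S * r)) \<bullet> (s, 1)) / (1 + s\<^sup>2) = - (S * c)"
      by (simp add: inner_prod_def c_def minus_divide_left algebra_simps)
    then have "mirror (s, 1) (S * q, - (S * r)) = (S * q, - (S * r)) + (S * c) *\<^sub>R (s, 1)"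
      unfolding mirror_def n by simp
    then show ?thesis
      using incoming_velocity_state[OF assms(1)] inward_normal_state[OF assms(1)] unfolding outgoing_velocity_def r1
      by (simp add: state_def r_def s_def q1_def algebra_simps)
  qed
  ultimately show ?thesis
    by blast
qed

lemma outgoing_velocity_reflects:
  assumes "\<bar>x\<bar> \<le> X" "\<bar>q\<bar> \<le> X" "\<bar>q1\<bar> \<le> X" "reflects \<eta> x q q1"
  shows "outgoing_velocity g E (state m x q) = (S * q1, S * rho \<eta> x q1)"
proof -
  define c where "c = S * (rho \<eta> x q + rho \<eta> x q1)"
  have c: "c \<noteq> 0"
    using rho_X_bounds[OF assms(1,2)] rho_X_bounds[OF assms(1,3)] S_pos by (simp add: c_def)
  have eq: "(S * q1, S * rho \<eta> x q1) = (S * q, - (S * rho \<eta> x q)) + c *\<^sub>R (sin x, 1)"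
  proof -
    have "q1 = q + sin x * (rho \<eta> x q + rho \<eta> x q1)"
      using assms(4) unfolding reflects_def by linarith
    then have "S * q1 = S * (q + sin x * (rho \<eta> x q + rho \<eta> x q1))"
      by (rule arg_cong)
    also have "\<dots> = S * q + c * sin x"
      by (simp add: c_def algebra_simps)
    finally show ?thesis
      by (simp add: c_def algebra_simps)
  qed
  have "q1\<^sup>2 + (rho \<eta> x q1)\<^sup>2 = q\<^sup>2 + (rho \<eta> x q)\<^sup>2"
    using rho_squared[of x q] rho_squared[of x q1] assms(1-3) X_pos by simp
  then have "norm (S * q1, S * rho \<eta> x q1) = norm (S * q, - (S * rho \<eta> x q))"
    by (simp add: norm_Pair power_mult_distrib flip: distrib_left)
  then have "mirror (sin x, 1) (S * q, - (S * rho \<eta> x q)) = (S * q1, S * rho \<eta> x q1)"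
    unfolding eq by (intro mirror_eqI c) (simp_all add: zero_prod_def)
  then show ?thesis
    using incoming_velocity_state[OF assms(1)] inward_normal_state[OF assms(1)]
    by (simp add: outgoing_velocity_def state_def)
qed

lemma flies_iff:
  "flies \<eta> n x x1 q \<longleftrightarrow>
    2 * E * (q * (rho \<eta> x q + rho \<eta> x1 q)) = g * (pi * of_int n + x1 - x)"
proof -
  have "2 * E * (\<eta> / 2 * Y) = g * Y" for Y
    using E_pos by (simp add: eta_eq)
  moreover have "A = B \<longleftrightarrow> 2 * E * A = 2 * E * B" for A B
    using E_pos by simp
  ultimately show ?thesis
    unfolding flies_def by metis
qed

text \<open>The time of flight is \<open>S * (rho \<eta> x q1 + rho \<eta> x1 q1) / g\<close>, because the vertical velocity
decreases at rate \<open>g\<close> from the first to minus the second speed. The horizontal motion during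
this time gives the flight equation; the heights then agree by conservation of energy. No
earlier collision occurs: in the first half of the flight the trajectory rises over the
starting point faster than the boundary can, and in the second half the same holds backwards in
time from the end point.\<close>
lemma return_graph_state_iff:
  assumes b: "\<bar>x\<bar> \<le> X" "\<bar>q\<bar> \<le> X" "\<bar>x1\<bar> \<le> X" "\<bar>q1\<bar> \<le> X"
  shows "(state m x q, state m1 x1 q1) \<in> return_graph g E \<longleftrightarrow>
    reflects \<eta> x q q1 \<and> flies \<eta> (m1 - m) x x1 q1"
proof
  assume "(state m x q, state m1 x1 q1) \<in> return_graph g E"
  then obtain t where
    fl: "flight g (boundary_point (top_at m x)) (outgoing_velocity g E (state m x q)) t = boundary_point (top_at m1 x1)"
    and vel: "flight_velocity g (outgoing_velocity g E (state m x q)) t = incoming_velocity g E (state m1 x1 q1)"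
    by (auto simp: return_graph_def state_def)
  obtain q' where q': "reflects \<eta> x q q'" "outgoing_velocity g E (state m x q) = (S * q', S * rho \<eta> x q')"
    using outgoing_velocity_state[OF b(1,2)] by blast
  have "q' = q1" and t: "g * t = S * (rho \<eta> x q1 + rho \<eta> x1 q1)"
    using vel S_pos unfolding q' incoming_velocity_state[OF b(3)] flight_velocity_def
    by (auto simp: algebra_simps)
  have "top_at m x + t * (S * q1) = top_at m1 x1"
    using fl unfolding q' \<open>q' = q1\<close> by (simp add: flight_def boundary_point_def)
  then have "t * (S * q1) = pi * of_int (m1 - m) + x1 - x"
    by (simp add: top_at_def algebra_simps)
  then have "g * t * (S * q1) = g * (pi * of_int (m1 - m) + x1 - x)"
    by simp
  then have "S\<^sup>2 * (q1 * (rho \<eta> x q1 + rho \<eta> x1 q1)) = g * (pi * of_int (m1 - m) + x1 - x)"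
    unfolding t by (simp only: power2_eq_square ac_simps)
  then have "2 * E * (q1 * (rho \<eta> x q1 + rho \<eta> x1 q1)) = g * (pi * of_int (m1 - m) + x1 - x)"
    unfolding S_sq .
  then have "flies \<eta> (m1 - m) x x1 q1"
    unfolding flies_iff .
  with q'(1) \<open>q' = q1\<close> show "reflects \<eta> x q q1 \<and> flies \<eta> (m1 - m) x x1 q1"
    by simp
next
  assume "reflects \<eta> x q q1 \<and> flies \<eta> (m1 - m) x x1 q1"
  then have refl: "reflects \<eta> x q q1" and flies: "flies \<eta> (m1 - m) x x1 q1"
    by auto
  define w v v1 where "w = S * q1" and "v = S * rho \<eta> x q1" and "v1 = S * rho \<eta> x1 q1"
  define t where "t = (v + v1) / g"
  define \<theta> where "\<theta> = top_at m x"
  have r: "99 / 100 \<le> rho \<eta> x q1" "rho \<eta> x q1 \<le> 1" "99 / 100 \<le> rho \<eta> x1 q1" "rho \<eta> x1 q1 \<le> 1"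
    using rho_X_bounds[OF b(1,4)] rho_X_bounds[OF b(3,4)] by auto
  have v: "99 / 100 * S \<le> v" "v \<le> S" "99 / 100 * S \<le> v1" "v1 \<le> S"
    unfolding v_def v1_def using r S_pos by (auto simp: mult.commute)
  have w: "\<bar>w\<bar> \<le> S / 100"
    unfolding w_def using b(4) X_small S_pos by (simp add: abs_mult)
  have t_pos: "0 < t"
    unfolding t_def using v S_pos g_pos by simp
  have gt: "g * t = v + v1"
    unfolding t_def using g_pos by simp
  have out: "outgoing_velocity g E (state m x q) = (w, v)"
    unfolding w_def v_def by (rule outgoing_velocity_reflects[OF b(1,2,4) refl])
  have "2 * E * (q1 * (rho \<eta> x q1 + rho \<eta> x1 q1)) = g * (pi * of_int (m1 - m) + x1 - x)"
    using flies unfolding flies_iff .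
  then have "g * (t * w) = g * (pi * of_int (m1 - m) + x1 - x)"
    unfolding mult.assoc[symmetric] gt w_def v_def v1_def S_sq[symmetric]
    by (simp add: power2_eq_square algebra_simps)
  then have "t * w = pi * of_int (m1 - m) + x1 - x"
    using g_pos by simp
  then have angle: "\<theta> + t * w = top_at m1 x1"
    by (simp add: \<theta>_def top_at_def algebra_simps)
  have cos_pos: "0 < cos x" "0 < cos x1"
    using cos_offset_pos b by force+
  have "v\<^sup>2 - v1\<^sup>2 = 2 * g * (cos x1 - cos x)"
    unfolding v_def v1_def power_mult_distrib S_sq
    using rho_squared[of x q1] rho_squared[of x1 q1] b X_pos E_pos by (simp add: eta_eq field_simps)
  then have "(v + v1) * (v - v1) = 2 * g * (cos x1 - cos x)"
    by (simp add: power2_eq_square algebra_simps)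
  then have "g * (t * (v - v1)) = g * (2 * (cos x1 - cos x))"
    unfolding mult.assoc[symmetric] gt by simp
  then have "t * (v - v1) = 2 * (cos x1 - cos x)"
    using g_pos by simp
  moreover have "t * v - g * t\<^sup>2 / 2 = t * (v - v1) / 2"
  proof -
    have "g * t\<^sup>2 = t * (v + v1)"
      unfolding gt[symmetric] by (simp add: power2_eq_square)
    then show ?thesis
      by (simp add: algebra_simps)
  qed
  ultimately have height: "cos x + t * v - g * t\<^sup>2 / 2 = cos x1"
    by simp
  have bp: "boundary_point \<theta> = (\<theta>, cos x)" "boundary_point (top_at m1 x1) = (top_at m1 x1, cos x1)"
    using cos_pos by (simp_all add: boundary_point_def \<theta>_def abs_sin_top_at)
  have land: "flight g (boundary_point \<theta>) (w, v) t = boundary_point (top_at m1 x1)"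
    unfolding bp using angle height by (simp add: flight_def)
  have free: "flight g (boundary_point \<theta>) (w, v) s \<in> billiard_table - range boundary_point"
    if s: "0 < s" "s < t" for s
  proof -
    have "\<bar>sin (\<theta> + s * w)\<bar> < cos x + s * v - g * s\<^sup>2 / 2"
    proof (cases "s \<le> t / 2")
      case True
      have "g * s \<le> g * (t / 2)"
        using True g_pos by (intro mult_left_mono) auto
      also have "\<dots> = (v + v1) / 2"
        using gt by simp
      also have "\<dots> \<le> S"
        using v(2,4) by simp
      finally have "g * s / 2 \<le> S / 2"
        by simp
      then have "\<bar>w\<bar> < v - g * s / 2"
        using v(1) w S_pos by simp
      from abs_sin_less_rise[OF s(1) this, of \<theta>] show ?thesis
        using cos_pos by (simp add: \<theta>_def abs_sin_top_at power2_eq_square algebra_simps)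
    next
      case False
      define u where "u = t - s"
      have u: "0 < u" "u \<le> t / 2"
        using False s by (simp_all add: u_def)
      have "g * u \<le> g * (t / 2)"
        using u(2) g_pos by (intro mult_left_mono) auto
      also have "\<dots> = (v + v1) / 2"
        using gt by simp
      also have "\<dots> \<le> S"
        using v(2,4) by simp
      finally have "g * u / 2 \<le> S / 2"
        by simp
      then have "\<bar>- w\<bar> < v1 - g * u / 2"
        using v(3) w S_pos by simp
      from abs_sin_less_rise[OF u(1) this, of "top_at m1 x1"]
      have "\<bar>sin (top_at m1 x1 - u * w)\<bar> < cos x1 + u * (v1 - g * u / 2)"
        using cos_pos by (simp add: abs_sin_top_at)
      moreover have "top_at m1 x1 - u * w = \<theta> + s * w"
        unfolding angle[symmetric] u_def by (simp add: algebra_simps)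
      moreover have "cos x1 + u * (v1 - g * u / 2) = cos x + s * v - g * s\<^sup>2 / 2"
      proof -
        have "v1 = g * t - v"
          using gt by simp
        then show ?thesis
          unfolding height[symmetric] u_def \<open>v1 = g * t - v\<close> by (simp add: power2_eq_square field_simps)
      qed
      ultimately show ?thesis
        by simp
    qed
    then show ?thesis
      unfolding bp by (auto simp: flight_def billiard_table_def boundary_point_def)
  qed
  have "next_collision_time g (boundary_point \<theta>) (w, v) t"
    unfolding next_collision_time_def using t_pos land free by auto
  moreover have "flight_velocity g (w, v) t = incoming_velocity g E (state m1 x1 q1)"
    unfolding incoming_velocity_state[OF b(3)] flight_velocity_def using gt
    by (simp add: w_def v1_def)
  ultimately show "(state m x q, state m1 x1 q1) \<in> return_graph g E"
    unfolding return_graph_def using state_in_P_down[OF b(1,2)] state_in_P_down[OF b(3,4)] land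
    by (auto simp: out \<theta>_def) (auto simp: state_def)
qed

end

section \<open>Invertibility of the return map\<close>

text \<open>Two flights with the same end and final velocity are pieces of one parabola.\<close>
lemma flight_backwards:
  assumes "flight g p v t = flight g p' v' t'" "flight_velocity g v t = flight_velocity g v' t'"
  shows "flight g p' v' (t' - t) = p" "t = t' \<Longrightarrow> v = v'"
proof -
  have eq: "fst p = fst p' + t' * fst v' - t * fst v" "fst v = fst v'" "snd v = snd v' - g * t' + g * t"
    "snd p = snd p' + t' * snd v' - g * t'\<^sup>2 / 2 - t * snd v + g * t\<^sup>2 / 2"
    using assms by (auto simp: flight_def flight_velocity_def prod_eq_iff algebra_simps)
  then show "t = t' \<Longrightarrow> v = v'"
    by (simp add: prod_eq_iff)
  have "fst (flight g p' v' (t' - t)) = fst p"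
    unfolding eq(1) eq(2) by (simp add: flight_def algebra_simps)
  moreover have "snd (flight g p' v' (t' - t)) = snd p"
    unfolding eq(4) eq(3) by (simp add: flight_def power2_eq_square field_simps)
  ultimately show "flight g p' v' (t' - t) = p"
    by (simp add: prod_eq_iff)
qed

text \<open>Otherwise the shorter flight would start at an inner point of the longer one, which is not on
the boundary.\<close>
lemma next_collision_determines_start:
  assumes "next_collision_time g p v t" "next_collision_time g p' v' t'"
    and "p \<in> range boundary_point" "p' \<in> range boundary_point"
    and "flight g p v t = flight g p' v' t'" "flight_velocity g v t = flight_velocity g v' t'"
  shows "p = p' \<and> v = v'"
proof -
  have no_less: "\<not> s < s'"
    if "next_collision_time g q w s" "next_collision_time g q' w' s'" "q \<in> range boundary_point"
      "flight g q w s = flight g q' w' s'" "flight_velocity g w s = flight_velocity g w' s'"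
    for q w s q' w' s'
    using that flight_backwards(1)[OF that(4,5)] unfolding next_collision_time_def
    by (metis DiffD2 diff_gt_0_iff_gt diff_less_eq less_add_same_cancel1)
  have "\<not> t < t'" "\<not> t' < t"
    using no_less[OF assms(1,2,3,5,6)] no_less[OF assms(2,1,4) assms(5,6)[symmetric]] .
  then have "t = t'"
    by simp
  moreover have "flight g p' v' 0 = p'"
    by (simp add: flight_def)
  ultimately show ?thesis
    using flight_backwards[OF assms(5,6)] by simp
qed

lemma return_graph_inj:
  assumes "(z, z1) \<in> return_graph g E" "(z', z1) \<in> return_graph g E"
  shows "z = z'"
proof -
  obtain t where t: "next_collision_time g (boundary_point (fst z)) (outgoing_velocity g E z) t"
    "flight g (boundary_point (fst z)) (outgoing_velocity g E z) t = boundary_point (fst z1)"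
    "flight_velocity g (outgoing_velocity g E z) t = incoming_velocity g E z1"
    using assms(1) by (auto simp: return_graph_def)
  obtain t' where t': "next_collision_time g (boundary_point (fst z')) (outgoing_velocity g E z') t'"
    "flight g (boundary_point (fst z')) (outgoing_velocity g E z') t' = boundary_point (fst z1)"
    "flight_velocity g (outgoing_velocity g E z') t' = incoming_velocity g E z1"
    using assms(2) by (auto simp: return_graph_def)
  have "boundary_point (fst z) = boundary_point (fst z') \<and> outgoing_velocity g E z = outgoing_velocity g E z'"
    using t t' by (intro next_collision_determines_start[OF t(1) t'(1)]) auto
  then have \<theta>: "fst z = fst z'" and out: "outgoing_velocity g E z = outgoing_velocity g E z'"
    by (auto simp: boundary_point_def)
  have "incoming_velocity g E z = incoming_velocity g E z'"
    using out \<theta> unfolding outgoing_velocity_def by (metis mirror_mirror)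
  then show ?thesis
    using \<theta> by (cases z; cases z') (simp add: incoming_velocity_def)
qed

lemma cyl_return_graphE:
  assumes "(to_cylinder z, w1) \<in> cyl_return_graph g E"
  obtains z1 where "(z, z1) \<in> return_graph g E" "w1 = to_cylinder z1"
proof -
  obtain z' z1 where z': "(z', z1) \<in> return_graph g E" "to_cylinder z' = to_cylinder z" "w1 = to_cylinder z1"
    using assms unfolding cyl_return_graph_def by auto
  then obtain n :: int where n: "fst z = fst z' + 2 * pi * of_int n" "snd z = snd z'"
    using to_cylinder_eq_iff by metis
  define z2 where "z2 = (fst z1 + 2 * pi * of_int n, snd z1)"
  have "(z, z2) \<in> return_graph g E"
    using return_graph_translate[of "fst z'" "snd z'" "fst z1" "snd z1" g E n] z'(1) n
    by (cases z) (simp add: z2_def)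
  moreover have "to_cylinder z1 = to_cylinder z2"
    unfolding to_cylinder_eq_iff by (auto simp: z2_def)
  ultimately show ?thesis
    using that z'(3) by metis
qed

lemma single_valued_converse_cyl_return_graph: "single_valued ((cyl_return_graph g E)\<inverse>)"
proof (rule single_valuedI)
  fix w w1 w2
  assume "(w, w1) \<in> (cyl_return_graph g E)\<inverse>" and "(w, w2) \<in> (cyl_return_graph g E)\<inverse>"
  then obtain z z1 z' z2
    where 1: "(z1, z) \<in> return_graph g E" "w = to_cylinder z" "w1 = to_cylinder z1"
      and 2: "(z2, z') \<in> return_graph g E" "w = to_cylinder z'" "w2 = to_cylinder z2"
    unfolding cyl_return_graph_def by auto
  then obtain n :: int where n: "fst z' = fst z + 2 * pi * of_int n" "snd z' = snd z"
    using to_cylinder_eq_iff by metis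
  have "((fst z1 + 2 * pi * of_int n, snd z1), z') \<in> return_graph g E"
    using return_graph_translate[of "fst z1" "snd z1" "fst z" "snd z" g E n] 1(1) n
    by (cases z') simp
  with 2(1) have "z2 = (fst z1 + 2 * pi * of_int n, snd z1)"
    using return_graph_inj by metis
  then show "w1 = w2"
    using 1(3) 2(3) to_cylinder_eq_iff[of z1 z2] by auto
qed

section \<open>Full orbits of an injective partial map\<close>

lemma relpow_converse:
  fixes R :: "('a \<times> 'a) set"
  shows "(R\<inverse>) ^^ n = (R ^^ n)\<inverse>"
  by (induction n) (simp_all add: relpow_commute flip: converse_relcomp)

definition full_orbit :: "('a \<times> 'a) set \<Rightarrow> 'a set \<Rightarrow> (int \<Rightarrow> 'a) \<Rightarrow> bool" where
  "full_orbit G D W \<longleftrightarrow> (\<forall>i. W i \<in> D \<and> (W i, W (i + 1)) \<in> G)"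

lemma full_orbit_relpow:
  assumes "full_orbit G D W"
  shows "(W i, W (i + int n)) \<in> G ^^ n"
proof (induction n)
  case (Suc n)
  moreover have "(W (i + int n), W (i + int n + 1)) \<in> G"
    using assms by (simp add: full_orbit_def)
  ultimately show ?case
    by (simp add: relcomp.relcompI add.assoc add.commute[of 1])
qed simp

lemma full_orbit_in_iterates:
  assumes "full_orbit G D W"
  shows "W 0 \<in> (\<Inter>n::int. graph_iterate G n `` D)"
proof
  fix n :: int
  have "(W (- n), W 0) \<in> graph_iterate G n"
  proof (cases "0 \<le> n")
    case True
    then show ?thesis
      using full_orbit_relpow[OF assms, of "- n" "nat n"] by (simp add: graph_iterate_def)
  next
    case False
    then show ?thesis
      using full_orbit_relpow[OF assms, of 0 "nat (- n)"]
      by (simp add: graph_iterate_def relpow_converse)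
  qed
  moreover have "W (- n) \<in> D"
    using assms by (simp add: full_orbit_def)
  ultimately show "W 0 \<in> graph_iterate G n `` D"
    by blast
qed

text \<open>The intersection of the iterated images provides, for each \<open>n\<close>, some point of \<open>D\<close> that is \<open>n\<close>
steps away. As the map and its inverse are single-valued, these points lie on one orbit, and so
the intermediate points belong to \<open>D\<close> too.\<close>
lemma full_orbit_of_iterates:
  assumes G: "single_valued G" "single_valued (G\<inverse>)"
    and w: "w \<in> (\<Inter>n::int. graph_iterate G n `` D)"
  shows "\<exists>W. full_orbit G D W \<and> W 0 = w"
proof -
  have "\<exists>u\<in>D. (u, w) \<in> G ^^ n" for n
    using w by (auto simp: graph_iterate_def dest!: spec[of _ "int n"])
  then obtain a where a: "\<And>n. a n \<in> D" "\<And>n. (a n, w) \<in> G ^^ n"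
    by metis
  have "\<exists>u\<in>D. (w, u) \<in> G ^^ n" for n
  proof (cases n)
    case 0
    then show ?thesis
      using a(1,2)[of 0] by auto
  next
    case (Suc m)
    have "w \<in> graph_iterate G (- int (Suc m)) `` D"
      using w by blast
    then show ?thesis
      unfolding Suc graph_iterate_def relpow_converse by (auto simp del: relpow.simps of_nat_Suc)
  qed
  then obtain b where b: "\<And>n. b n \<in> D" "\<And>n. (w, b n) \<in> G ^^ n"
    by metis
  have b_step: "(b n, b (Suc n)) \<in> G" for n
  proof -
    obtain u where "(w, u) \<in> G ^^ n" "(u, b (Suc n)) \<in> G"
      using b(2)[of "Suc n"] by (rule relpow_Suc_E)
    moreover have "single_valued (G ^^ n)"
      using G(1) by (rule single_valued_relpow)
    ultimately show ?thesis
      using b(2)[of n] by (metis single_valuedD)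
  qed
  have a_step: "(a (Suc n), a n) \<in> G" for n
  proof -
    obtain u where "(a (Suc n), u) \<in> G" "(u, w) \<in> G ^^ n"
      using a(2)[of "Suc n"] by (rule relpow_Suc_E2)
    moreover have "single_valued ((G ^^ n)\<inverse>)"
      unfolding relpow_converse[symmetric] using G(2) by (rule single_valued_relpow)
    ultimately show ?thesis
      using a(2)[of n] by (metis single_valuedD converse_iff)
  qed
  define W where "W i = (if 0 \<le> i then b (nat i) else a (nat (- i)))" for i :: int
  have "(W i, W (i + 1)) \<in> G" for i
  proof (cases "0 \<le> i")
    case True
    then show ?thesis
      using b_step[of "nat i"] by (simp add: W_def nat_add_distrib)
  next
    case False
    then obtain n where n: "i = - 1 - int n"
      by (intro that[of "nat (- 1 - i)"]) simp
    have "W (i + 1) = a n"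
      using a(2)[of 0] b(2)[of 0] by (cases n) (auto simp: W_def n nat_add_distrib)
    moreover have "W i = a (Suc n)"
      by (simp add: W_def n nat_add_distrib)
    ultimately show ?thesis
      using a_step by simp
  qed
  then have "full_orbit G D W"
    unfolding full_orbit_def using a(1) b(1) by (simp add: W_def)
  moreover have "W 0 = w"
    using b(2)[of 0] by (simp add: W_def)
  ultimately show ?thesis
    by blast
qed

lemma full_orbit_unique:
  assumes G: "single_valued G" "single_valued (G\<inverse>)"
    and W: "full_orbit G D W" "full_orbit G D W'" "W 0 = W' 0"
  shows "W i = W' i"
proof (induction i rule: int_induct[where k = 0])
  case base
  show ?case
    by (rule W(3))
next
  case (step1 i)
  have "(W i, W (i + 1)) \<in> G" "(W' i, W' (i + 1)) \<in> G"
    using W(1,2) by (simp_all add: full_orbit_def)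
  then show ?case
    using step1 G(1) by (metis single_valuedD)
next
  case (step2 i)
  have "(W (i - 1), W (i - 1 + 1)) \<in> G" "(W' (i - 1), W' (i - 1 + 1)) \<in> G"
    using W(1,2) unfolding full_orbit_def by blast+
  then show ?case
    using step2 G(2) by (auto dest: single_valuedD)
qed

section \<open>Collisions on the cylinder\<close>

context coin_billiard
begin

definition cyl_state :: "int \<Rightarrow> real \<Rightarrow> real \<Rightarrow> complex \<times> real" where
  "cyl_state m x q = to_cylinder (state m x q)"

lemma cyl_state_parity:
  assumes "even (m - m')"
  shows "cyl_state m x q = cyl_state m' x q"
proof -
  obtain j where "m - m' = 2 * j"
    using assms by (rule evenE)
  then have "m = m' + 2 * j"
    by simp
  then show ?thesis
    unfolding cyl_state_def to_cylinder_eq_iff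
    by (intro conjI exI[of _ "- j"]) (simp_all add: state_def top_at_def algebra_simps)
qed

text \<open>On the cylinder only the parity of the number of a top survives: even ones are the top at
\<open>\<pi>/2\<close>, odd ones the top at \<open>3\<pi>/2\<close>.\<close>
lemma cyl_state_inj:
  assumes "cyl_state m x q = cyl_state m' x' q'" "\<bar>x\<bar> \<le> X" "\<bar>x'\<bar> \<le> X"
  shows "even (m - m') \<and> x = x' \<and> q = q'"
proof -
  obtain n :: int where n: "top_at m' x' = top_at m x + 2 * pi * of_int n" and q: "S * q' = S * q"
    using assms(1) unfolding cyl_state_def to_cylinder_eq_iff by (auto simp: state_def)
  define j where "j = m' - m - 2 * n"
  have j: "x - x' = pi * of_int j"
    using n by (simp add: top_at_def j_def algebra_simps)
  have "\<bar>x - x'\<bar> < pi"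
    using assms(2,3) X_small pi_ge_two by (simp add: abs_less_iff abs_le_iff)
  then have "pi * \<bar>real_of_int j\<bar> < pi * 1"
    unfolding j by (simp add: abs_mult)
  then have "\<bar>real_of_int j\<bar> < 1"
    by (simp only: mult_less_cancel_left_pos[OF pi_gt_zero])
  then have "j = 0"
    by linarith
  then have "m - m' = 2 * (- n)"
    by (simp add: j_def)
  with j q \<open>j = 0\<close> S_pos show ?thesis
    by simp
qed

lemma angular_velocity_bound_eq: "sqrt 2 * k / sqrt E = S * X"
  unfolding S_def X_eq by (rule angular_velocity_scaled[OF E_pos])

lemma D_cyl_iff:
  "w \<in> D_cyl g E k \<longleftrightarrow>
    (\<exists>m x q. (m = 0 \<or> m = 1) \<and> \<bar>x\<bar> \<le> X \<and> \<bar>q\<bar> \<le> X \<and> w = cyl_state m x q)"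
proof -
  have box: "\<bar>\<omega>\<bar> \<le> S * X \<longleftrightarrow> \<bar>\<omega> / S\<bar> \<le> X" for \<omega>
    using S_pos by (simp add: abs_divide pos_divide_le_eq mult.commute)
  have st: "(\<theta>, \<omega>) = state 0 (\<theta> - pi / 2) (\<omega> / S)" "(\<theta>, \<omega>) = state 1 (\<theta> - 3 * pi / 2) (\<omega> / S)" for \<theta> \<omega>
    using S_pos by (simp_all add: state_def top_at_def)
  have L: "D_left g E k = {state 0 x q |x q. \<bar>x\<bar> \<le> X \<and> \<bar>q\<bar> \<le> X}" (is "_ = ?L")
  proof (intro set_eqI iffI)
    fix z assume "z \<in> D_left g E k"
    then show "z \<in> ?L"
      unfolding D_left_def angular_velocity_bound_eq X_eq[symmetric] using box st(1) by blast
  next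
    fix z assume "z \<in> ?L"
    then obtain x q where z: "z = state 0 x q" "\<bar>x\<bar> \<le> X" "\<bar>q\<bar> \<le> X"
      by blast
    then show "z \<in> D_left g E k"
      using state_in_P_down[of x q 0] S_pos unfolding D_left_def angular_velocity_bound_eq X_eq[symmetric]
      by (auto simp: state_def top_at_def abs_mult)
  qed
  have R: "D_right g E k = {state 1 x q |x q. \<bar>x\<bar> \<le> X \<and> \<bar>q\<bar> \<le> X}" (is "_ = ?R")
  proof (intro set_eqI iffI)
    fix z assume "z \<in> D_right g E k"
    then show "z \<in> ?R"
      unfolding D_right_def angular_velocity_bound_eq X_eq[symmetric] using box st(2) by blast
  next
    fix z assume "z \<in> ?R"
    then obtain x q where z: "z = state 1 x q" "\<bar>x\<bar> \<le> X" "\<bar>q\<bar> \<le> X"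
      by blast
    then show "z \<in> D_right g E k"
      using state_in_P_down[of x q 1] S_pos unfolding D_right_def angular_velocity_bound_eq X_eq[symmetric]
      by (auto simp: state_def top_at_def abs_mult)
  qed
  show ?thesis
    unfolding D_cyl_def L R cyl_state_def by blast
qed

lemma cyl_state_in_D_cyl:
  assumes "\<bar>x\<bar> \<le> X" "\<bar>q\<bar> \<le> X"
  shows "cyl_state m x q \<in> D_cyl g E k"
proof -
  have "m mod 2 = 0 \<or> m mod 2 = 1"
    by presburger
  moreover have "cyl_state m x q = cyl_state (m mod 2) x q"
    by (rule cyl_state_parity) (rule dvd_minus_mod)
  ultimately show ?thesis
    unfolding D_cyl_iff using assms by (intro exI conjI)
qed

lemma cyl_return_graph_state_iff:
  assumes b: "\<bar>x\<bar> \<le> X" "\<bar>q\<bar> \<le> X" "\<bar>x1\<bar> \<le> X" "\<bar>q1\<bar> \<le> X"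
  shows "(cyl_state m x q, cyl_state m1 x1 q1) \<in> cyl_return_graph g E \<longleftrightarrow>
    (\<exists>n. even (m1 - m - n) \<and> reflects \<eta> x q q1 \<and> flies \<eta> n x x1 q1)"
proof
  assume "(cyl_state m x q, cyl_state m1 x1 q1) \<in> cyl_return_graph g E"
  then obtain z1 where z1: "(state m x q, z1) \<in> return_graph g E" "cyl_state m1 x1 q1 = to_cylinder z1"
    unfolding cyl_state_def by (rule cyl_return_graphE)
  then obtain j :: int where "fst z1 = fst (state m1 x1 q1) + 2 * pi * of_int j" "snd z1 = snd (state m1 x1 q1)"
    unfolding cyl_state_def to_cylinder_eq_iff by blast
  then have "z1 = state (m1 + 2 * j) x1 q1"
    by (simp add: prod_eq_iff state_def top_at_def algebra_simps)
  then have "reflects \<eta> x q q1 \<and> flies \<eta> (m1 + 2 * j - m) x x1 q1"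
    using z1(1) return_graph_state_iff[OF b] by simp
  moreover have "even (m1 - m - (m1 + 2 * j - m))"
    by simp
  ultimately show "\<exists>n. even (m1 - m - n) \<and> reflects \<eta> x q q1 \<and> flies \<eta> n x x1 q1"
    by blast
next
  assume "\<exists>n. even (m1 - m - n) \<and> reflects \<eta> x q q1 \<and> flies \<eta> n x x1 q1"
  then obtain n where n: "even (m1 - m - n)" "reflects \<eta> x q q1" "flies \<eta> n x x1 q1"
    by blast
  have "(state m x q, state (m + n) x1 q1) \<in> return_graph g E"
    using n return_graph_state_iff[OF b] by simp
  moreover have "cyl_state m1 x1 q1 = cyl_state (m + n) x1 q1"
    using n(1) by (intro cyl_state_parity) (simp add: diff_diff_eq)
  ultimately show "(cyl_state m x q, cyl_state m1 x1 q1) \<in> cyl_return_graph g E"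
    unfolding cyl_return_graph_def cyl_state_def by force
qed

lemma coin_invariant_set_iff:
  "w \<in> coin_invariant_set g E k \<longleftrightarrow> (\<exists>W. full_orbit (cyl_return_graph g E) (D_cyl g E k) W \<and> W 0 = w)"
  unfolding coin_invariant_set_def
  using full_orbit_of_iterates[OF single_valued_cyl_return_graph single_valued_converse_cyl_return_graph]
    full_orbit_in_iterates by metis

end

section \<open>Coding by symbol sequences\<close>

fun side :: "coin_symbol \<Rightarrow> int" where
  "side L1 = 0" | "side L2 = 0" | "side L3 = 0"
| "side R1 = 1" | "side R2 = 1" | "side R3 = 1"

lemma side_cases: "side a = 0 \<or> side a = 1"
  by (cases a) auto

text \<open>A flight by \<open>n\<close> half turns changes the parity of the top by that of \<open>n\<close>. The admissible
successors are exactly those that respect this; in particular the moves themselves are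
arbitrary.\<close>
lemma may_follow_iff: "may_follow a b \<longleftrightarrow> even (side b - side a - move b)"
  by (cases a; cases b) (simp_all add: may_follow_def)

lemma symbol_eqI: "side a = side b \<Longrightarrow> move a = move b \<Longrightarrow> a = b"
  by (cases a; cases b) simp_all

lemma symbol_exists:
  assumes "m = 0 \<or> m = 1" "\<bar>n\<bar> \<le> 1"
  shows "\<exists>a. side a = m \<and> move a = n"
proof -
  have "n = - 1 \<or> n = 0 \<or> n = 1"
    using assms(2) by linarith
  then show ?thesis
    using assms(1) side.simps move.simps by metis
qed

lemma continuous_map_from_coin_sequences:
  fixes f :: "(int \<Rightarrow> coin_symbol) \<Rightarrow> 'a::topological_space"
  assumes "\<And>s U. s \<in> coin_sequences \<Longrightarrow> open U \<Longrightarrow> f s \<in> U \<Longrightarrow>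
    \<exists>m::nat. \<forall>s'\<in>coin_sequences. (\<forall>i. \<bar>i\<bar> < int m \<longrightarrow> s i = s' i) \<longrightarrow> f s' \<in> U"
  shows "continuous_map coin_sequence_topology euclidean f"
proof -
  have top: "topspace coin_sequence_topology = coin_sequences"
    by (simp add: coin_sequence_topology_def)
  have "openin coin_sequence_topology {s \<in> coin_sequences. f s \<in> U}" if U: "open U" for U
  proof (subst openin_subopen, intro ballI)
    fix s
    assume "s \<in> {s \<in> coin_sequences. f s \<in> U}"
    then have s: "s \<in> coin_sequences" "f s \<in> U"
      by auto
    obtain m :: nat where m: "\<And>s'. s' \<in> coin_sequences \<Longrightarrow> \<forall>i. \<bar>i\<bar> < int m \<longrightarrow> s i = s' i \<Longrightarrow> f s' \<in> U"
      using assms[OF s(1) U s(2)] by blast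
    define P where "P = product_topology (\<lambda>_::int. discrete_topology (UNIV :: coin_symbol set)) UNIV"
    define I where "I = {- int m..int m}"
    have "openin P {s' \<in> topspace P. s' i \<in> {s i}}" for i
      unfolding P_def
      by (rule openin_continuous_map_preimage[OF continuous_map_product_projection]) auto
    then have "openin P (\<Inter>i\<in>I. {s' \<in> topspace P. s' i \<in> {s i}})"
      by (intro openin_INT2) (auto simp: I_def)
    then have "openin coin_sequence_topology (coin_sequences \<inter> (\<Inter>i\<in>I. {s' \<in> topspace P. s' i \<in> {s i}}))"
      unfolding coin_sequence_topology_def P_def by (rule openin_subtopology_Int2)
    moreover have "s \<in> coin_sequences \<inter> (\<Inter>i\<in>I. {s' \<in> topspace P. s' i \<in> {s i}})"
      using s(1) by (auto simp: P_def)
    moreover have "coin_sequences \<inter> (\<Inter>i\<in>I. {s' \<in> topspace P. s' i \<in> {s i}}) \<subseteq> {s \<in> coin_sequences. f s \<in> U}"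
    proof
      fix s'
      assume s': "s' \<in> coin_sequences \<inter> (\<Inter>i\<in>I. {s' \<in> topspace P. s' i \<in> {s i}})"
      then have "s i = s' i" if "i \<in> I" for i
        using that by auto
      then have "\<forall>i. \<bar>i\<bar> < int m \<longrightarrow> s i = s' i"
        by (simp add: I_def abs_less_iff)
      with s' show "s' \<in> {s \<in> coin_sequences. f s \<in> U}"
        using m by blast
    qed
    ultimately show "\<exists>T. openin coin_sequence_topology T \<and> s \<in> T \<and> T \<subseteq> {s \<in> coin_sequences. f s \<in> U}"
      by blast
  qed
  then show ?thesis
    by (simp add: continuous_map_def top)
qed

lemma compact_space_coin_sequences: "compact_space coin_sequence_topology"
proof -
  define P where "P = product_topology (\<lambda>_::int. discrete_topology (UNIV :: coin_symbol set)) UNIV"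
  have "(UNIV :: coin_symbol set) = {L1, L2, L3, R1, R2, R3}"
    using coin_symbol.exhaust by blast
  then have "finite (UNIV :: coin_symbol set)"
    by (metis finite.emptyI finite.insertI)
  then have "compact_space P"
    by (simp add: P_def compact_space_product_topology compact_space_discrete_topology)
  have proj: "closedin P {s \<in> topspace P. s i \<in> A}" for i A
    unfolding P_def
    by (rule closedin_continuous_map_preimage[OF continuous_map_product_projection]) auto
  have "closedin P (\<Inter>i. \<Inter>a. {s \<in> topspace P. s i \<in> - {a}} \<union> {s \<in> topspace P. s (i + 1) \<in> {b. may_follow a b}})"
    by (intro closedin_INT closedin_Un proj) auto
  also have "(\<Inter>i. \<Inter>a. {s \<in> topspace P. s i \<in> - {a}} \<union> {s \<in> topspace P. s (i + 1) \<in> {b. may_follow a b}}) = coin_sequences"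
    by (auto simp: P_def coin_sequences_def)
  finally have "closedin P coin_sequences" .
  with \<open>compact_space P\<close> show ?thesis
    unfolding coin_sequence_topology_def P_def
    by (intro compact_space_subtopology closedin_compact_space)
qed

lemma shift_in_coin_sequences: "s \<in> coin_sequences \<Longrightarrow> shift s \<in> coin_sequences"
  unfolding coin_sequences_def shift_def mem_Collect_eq by blast

context coin_billiard
begin

abbreviation G :: "((complex \<times> real) \<times> (complex \<times> real)) set" where
  "G \<equiv> cyl_return_graph g E"

abbreviation D :: "(complex \<times> real) set" where
  "D \<equiv> D_cyl g E k"

definition traced_orbit :: "(int \<Rightarrow> coin_symbol) \<Rightarrow> (int \<Rightarrow> real) \<Rightarrow> (int \<Rightarrow> real) \<Rightarrow> int \<Rightarrow> complex \<times> real" where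
  "traced_orbit s x q i = cyl_state (side (s i)) (x i) (q i)"

lemma shadowsD:
  assumes "shadows s x q"
  shows "\<bar>x i\<bar> \<le> X" "\<bar>q i\<bar> \<le> X" "flies \<eta> (move (s i)) (x (i - 1)) (x i) (q i)"
    "reflects \<eta> (x i) (q i) (q (i + 1))"
  using assms unfolding shadows_def by blast+

lemma full_orbit_traced_orbit:
  assumes "s \<in> coin_sequences" "shadows s x q"
  shows "full_orbit G D (traced_orbit s x q)"
  unfolding full_orbit_def
proof (intro allI conjI)
  fix i
  note sh = shadowsD[OF assms(2)]
  show "traced_orbit s x q i \<in> D"
    unfolding traced_orbit_def by (intro cyl_state_in_D_cyl sh)
  have "even (side (s (i + 1)) - side (s i) - move (s (i + 1)))"
    using assms(1) by (simp add: coin_sequences_def may_follow_iff)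
  moreover have "flies \<eta> (move (s (i + 1))) (x i) (x (i + 1)) (q (i + 1))"
    using sh(3)[of "i + 1"] by simp
  ultimately show "(traced_orbit s x q i, traced_orbit s x q (i + 1)) \<in> G"
    unfolding traced_orbit_def cyl_return_graph_state_iff[OF sh(1,2,1,2)] using sh(4) by blast
qed

text \<open>The symbol of a collision records its top and the number of half turns of the flight that leads
to it.\<close>
lemma full_orbit_imp_traced:
  assumes "full_orbit G D W"
  shows "\<exists>s\<in>coin_sequences. \<exists>x q. shadows s x q \<and> W = traced_orbit s x q"
proof -
  have "\<forall>i. \<exists>m x q. (m = 0 \<or> m = 1) \<and> \<bar>x\<bar> \<le> X \<and> \<bar>q\<bar> \<le> X \<and> W i = cyl_state m x q"
    using assms unfolding full_orbit_def D_cyl_iff by blast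
  then obtain m x q where W: "\<And>i. m i = 0 \<or> m i = 1" "\<And>i. \<bar>x i\<bar> \<le> X" "\<And>i. \<bar>q i\<bar> \<le> X"
    "\<And>i. W i = cyl_state (m i) (x i) (q i)"
    by metis
  have "\<exists>n. even (m (i + 1) - m i - n) \<and> reflects \<eta> (x i) (q i) (q (i + 1)) \<and>
      flies \<eta> n (x i) (x (i + 1)) (q (i + 1))" for i
  proof -
    have "(W i, W (i + 1)) \<in> G"
      using assms by (simp add: full_orbit_def)
    then show ?thesis
      unfolding W(4) by (rule cyl_return_graph_state_iff[OF W(2,3,2,3), THEN iffD1])
  qed
  then obtain n where n: "\<And>i. even (m (i + 1) - m i - n i)"
    "\<And>i. reflects \<eta> (x i) (q i) (q (i + 1))" "\<And>i. flies \<eta> (n i) (x i) (x (i + 1)) (q (i + 1))"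
    by metis
  have "\<exists>a. side a = m i \<and> move a = n (i - 1)" for i
    by (intro symbol_exists W(1) half_turns_le_1[OF W(2,2,3) n(3)])
  then obtain s where s: "\<And>i. side (s i) = m i" "\<And>i. move (s i) = n (i - 1)"
    by metis
  have "s \<in> coin_sequences"
    unfolding coin_sequences_def mem_Collect_eq may_follow_iff s using n(1) by simp
  moreover have "shadows s x q"
    unfolding shadows_def s using W(2,3) n(2) n(3)[of "i - 1" for i] by simp
  moreover have "W = traced_orbit s x q"
    by (rule ext) (simp add: traced_orbit_def s W(4))
  ultimately show ?thesis
    by blast
qed

text \<open>The letter of a symbol is the parity of the top. Its index is determined by the velocity, even
though both \<open>1\<close> and \<open>3\<close> lead to the same top of the cylinder.\<close>
lemma traced_orbit_inj:
  assumes "shadows s x q" "shadows s' x' q'" "\<And>i. traced_orbit s x q i = traced_orbit s' x' q' i"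
  shows "s = s'"
proof
  fix i
  note sh = shadowsD[OF assms(1)] and sh' = shadowsD[OF assms(2)]
  have eq: "even (side (s i) - side (s' i)) \<and> x i = x' i \<and> q i = q' i" for i
    using assms(3)[of i] unfolding traced_orbit_def by (rule cyl_state_inj[OF _ sh(1) sh'(1)])
  have "side (s i) = side (s' i)"
    using eq[of i] side_cases[of "s i"] side_cases[of "s' i"] by auto
  moreover have "move (s i) = move (s' i)"
  proof (rule flight_determines_half_turns)
    show "flies \<eta> (move (s' i)) (x' (i - 1)) (x' i) (q i)"
      using sh'(3)[of i] eq[of i] by simp
  qed (use sh sh' in blast)+
  ultimately show "s i = s' i"
    by (rule symbol_eqI)
qed

definition decode :: "(int \<Rightarrow> coin_symbol) \<Rightarrow> complex \<times> real" where
  "decode s = (THE w. \<exists>x q. shadows s x q \<and> w = traced_orbit s x q 0)"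

lemma decode_eq:
  assumes "shadows s x q"
  shows "decode s = traced_orbit s x q 0"
  unfolding decode_def
proof (rule the_equality)
  show "\<exists>x' q'. shadows s x' q' \<and> traced_orbit s x q 0 = traced_orbit s x' q' 0"
    using assms by blast
  show "w = traced_orbit s x q 0" if "\<exists>x' q'. shadows s x' q' \<and> w = traced_orbit s x' q' 0" for w
    using that shadows_unique[OF assms] by blast
qed

lemma decode_in_invariant_set:
  assumes "s \<in> coin_sequences"
  shows "decode s \<in> coin_invariant_set g E k"
proof -
  obtain x q where "shadows s x q"
    using shadows_exists by blast
  with assms show ?thesis
    unfolding coin_invariant_set_iff using full_orbit_traced_orbit decode_eq by metis
qed

lemma decode_image: "decode ` coin_sequences = coin_invariant_set g E k"
proof
  show "decode ` coin_sequences \<subseteq> coin_invariant_set g E k"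
    using decode_in_invariant_set by blast
  show "coin_invariant_set g E k \<subseteq> decode ` coin_sequences"
  proof
    fix w
    assume "w \<in> coin_invariant_set g E k"
    then obtain W where W: "full_orbit G D W" "W 0 = w"
      unfolding coin_invariant_set_iff by blast
    then obtain s x q where "s \<in> coin_sequences" "shadows s x q" "W = traced_orbit s x q"
      using full_orbit_imp_traced by blast
    moreover from this have "w = decode s"
      using W(2) decode_eq by simp
    ultimately show "w \<in> decode ` coin_sequences"
      by blast
  qed
qed

lemma inj_on_decode: "inj_on decode coin_sequences"
proof
  fix s s'
  assume s: "s \<in> coin_sequences" "s' \<in> coin_sequences" and eq: "decode s = decode s'"
  obtain x q x' q' where sh: "shadows s x q" "shadows s' x' q'"
    using shadows_exists by blast
  show "s = s'"
  proof (rule traced_orbit_inj[OF sh])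
    fix i
    show "traced_orbit s x q i = traced_orbit s' x' q' i"
      using eq unfolding decode_eq[OF sh(1)] decode_eq[OF sh(2)]
      by (rule full_orbit_unique[OF single_valued_cyl_return_graph single_valued_converse_cyl_return_graph
            full_orbit_traced_orbit[OF s(1) sh(1)] full_orbit_traced_orbit[OF s(2) sh(2)]])
  qed
qed

lemma coin_map_decode:
  assumes "s \<in> coin_sequences"
  shows "coin_map g E (decode s) = decode (shift s)"
proof -
  obtain x q where sh: "shadows s x q"
    using shadows_exists by blast
  have "shadows (shift s) (shift x) (shift q)"
    unfolding shadows_def
  proof
    fix i
    show "\<bar>shift x i\<bar> \<le> X \<and> \<bar>shift q i\<bar> \<le> X \<and>
        flies \<eta> (move (shift s i)) (shift x (i - 1)) (shift x i) (shift q i) \<and>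
        reflects \<eta> (shift x i) (shift q i) (shift q (i + 1))"
      using shadowsD[OF sh, of "i + 1"] by (simp add: shift_def)
  qed
  then have "decode (shift s) = traced_orbit s x q 1"
    by (simp add: decode_eq traced_orbit_def shift_def)
  moreover have "(traced_orbit s x q 0, traced_orbit s x q (0 + 1)) \<in> G"
    using full_orbit_traced_orbit[OF assms sh] unfolding full_orbit_def by blast
  ultimately show ?thesis
    unfolding decode_eq[OF sh] by (intro coin_map_eq) simp
qed

lemma continuous_map_decode: "continuous_map coin_sequence_topology euclidean decode"
proof (rule continuous_map_from_coin_sequences)
  fix s U
  assume "s \<in> coin_sequences" and U: "open U" "decode s \<in> U"
  obtain x q where sh: "shadows s x q"
    using shadows_exists by blast
  define c where "c = (\<lambda>z. cyl_state (side (s 0)) (fst z) (snd z))"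
  have "continuous_on UNIV c"
    unfolding c_def cyl_state_def to_cylinder_def state_def top_at_def cis_conv_exp
    by (intro continuous_intros)
  then have "open (c -` U)"
    using U(1) by (simp add: open_vimage)
  moreover have "(x 0, q 0) \<in> c -` U"
    using U(2) by (simp add: decode_eq[OF sh] traced_orbit_def c_def)
  ultimately obtain e where e: "e > 0" "\<And>z. dist z (x 0, q 0) < e \<Longrightarrow> c z \<in> U"
    unfolding open_dist by (metis vimageE)
  have "(\<lambda>m. 2 * ((3 / 4) ^ m * diameter state_box)) \<longlonglongrightarrow> 2 * (0 * diameter state_box)"
    by (intro tendsto_intros LIMSEQ_power_zero) simp
  then have "\<forall>\<^sub>F m in sequentially. 2 * ((3 / 4) ^ m * diameter state_box) < e"
    using e(1) by (intro order_tendstoD(2)) auto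
  then obtain m where m: "2 * ((3 / 4) ^ m * diameter state_box) < e"
    by (auto simp: eventually_sequentially)
  show "\<exists>m::nat. \<forall>s'\<in>coin_sequences. (\<forall>i. \<bar>i\<bar> < int m \<longrightarrow> s i = s' i) \<longrightarrow> decode s' \<in> U"
  proof (intro exI[of _ "Suc m"] ballI impI)
    fix s'
    assume near: "\<forall>i. \<bar>i\<bar> < int (Suc m) \<longrightarrow> s i = s' i"
    obtain x' q' where sh': "shadows s' x' q'"
      using shadows_exists by blast
    have "\<forall>i. \<bar>i - 0\<bar> < int m \<longrightarrow> s i = s' i" and s0: "s 0 = s' 0"
      using near by auto
    from shadows_close[OF sh sh' this(1)]
    have "dist (x' 0, q' 0) (x 0, q 0) < e"
      using m norm_Pair_le[of "x' 0 - x 0" "q' 0 - q 0"] by (simp add: dist_norm abs_minus_commute)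
    then have "c (x' 0, q' 0) \<in> U"
      by (rule e(2))
    then show "decode s' \<in> U"
      by (simp add: decode_eq[OF sh'] traced_orbit_def c_def s0)
  qed
qed

theorem coin_map_conjugate_to_shift:
  "\<exists>\<phi>. homeomorphic_map (top_of_set (coin_invariant_set g E k)) coin_sequence_topology \<phi> \<and>
    (\<forall>w \<in> coin_invariant_set g E k. \<phi> (coin_map g E w) = shift (\<phi> w))"
proof -
  have top: "topspace coin_sequence_topology = coin_sequences"
    by (simp add: coin_sequence_topology_def)
  have "homeomorphic_map coin_sequence_topology (top_of_set (coin_invariant_set g E k)) decode"
  proof (rule continuous_imp_homeomorphic_map)
    show "continuous_map coin_sequence_topology (top_of_set (coin_invariant_set g E k)) decode"
      unfolding continuous_map_in_subtopology top using continuous_map_decode decode_in_invariant_set by blast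
    show "compact_space coin_sequence_topology"
      by (rule compact_space_coin_sequences)
    show "Hausdorff_space (top_of_set (coin_invariant_set g E k))"
      by (intro Hausdorff_space_subtopology Hausdorff_space_euclidean)
    show "decode ` topspace coin_sequence_topology = topspace (top_of_set (coin_invariant_set g E k))"
      by (simp add: top decode_image)
    show "inj_on decode (topspace coin_sequence_topology)"
      unfolding top by (rule inj_on_decode)
  qed
  then obtain \<phi> where \<phi>: "homeomorphic_maps coin_sequence_topology (top_of_set (coin_invariant_set g E k)) decode \<phi>"
    unfolding homeomorphic_map_maps by blast
  then have inv: "\<phi> (decode s) = s" if "s \<in> coin_sequences" for s
    using that by (simp add: homeomorphic_maps_map top)
  have "\<phi> (coin_map g E w) = shift (\<phi> w)" if w: "w \<in> coin_invariant_set g E k" for w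
  proof -
    obtain s where s: "s \<in> coin_sequences" "w = decode s"
      using w unfolding decode_image[symmetric] by blast
    then show ?thesis
      using coin_map_decode[OF s(1)] inv[OF s(1)] inv[OF shift_in_coin_sequences[OF s(1)]] by simp
  qed
  then show ?thesis
    using \<phi> unfolding homeomorphic_maps_map by blast
qed

end

section \<open>High energies\<close>

text \<open>In the corner condition the square root is \<open>sqrt (2 E)\<close> times the vertical speed after the
collision, so that the whole product is a flight angle.\<close>
lemma coin_billiard_of_corner_condition:
  fixes g E k :: real
  defines "X \<equiv> k / E" and "\<eta> \<equiv> g / E"
  defines "p \<equiv> - theta_dot_plus g E (corner_point E k) / sqrt (2 * E)"
  assumes "0 < g" "0 < E" "0 < k" "\<eta> \<le> 1 / 100" "X \<le> 1 / 100" "X\<^sup>2 \<le> \<eta> / 100"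
    and corner: "corner_condition g E k"
  shows "coin_billiard \<eta> X p g E k"
proof
  define S where "S = sqrt (2 * E)"
  define w where "w = theta_dot_plus g E (corner_point E k)"
  have S: "0 < S" "S\<^sup>2 = 2 * E"
    using \<open>0 < E\<close> by (simp_all add: S_def)
  show "0 < \<eta>" "0 < X"
    using assms by (simp_all add: X_def \<eta>_def)
  then have "X\<^sup>2 \<le> (1 / 100)\<^sup>2"
    using \<open>X \<le> 1 / 100\<close> by (intro power_mono) auto
  then have c: "0 < cos X"
    using one_minus_cos_le[of X] by (simp add: power2_eq_square)
  have "sqrt 2 * k / sqrt E = S * X"
    unfolding S_def X_def by (rule angular_velocity_scaled[OF \<open>0 < E\<close>])
  then have a: "corner_point E k = (pi / 2 - X, S * X)"
    by (simp add: corner_point_def X_def)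
  have trig: "sin (pi / 2 - X) = cos X" "cos (pi / 2 - X) = sin X"
    by (simp_all add: sin_diff cos_diff)
  have r: "sqrt (2 * E - 2 * g * \<bar>cos X\<bar> - (S * q)\<^sup>2) = S * rho \<eta> X q" for q
    using vertical_speed_scaled[OF \<open>0 < E\<close>, of X g q] c by (simp add: S_def \<eta>_def)
  have wp: "w = S * (- p)"
    using S by (simp add: p_def w_def S_def)
  have D: "0 < 1 + (sin X)\<^sup>2"
    by (intro add_pos_nonneg) auto
  have "w * (1 + (sin X)\<^sup>2) = S * X * (cos X)\<^sup>2 - 2 * (S * rho \<eta> X X) * sin X"
    using r[of X] c D by (simp add: w_def a theta_dot_plus_def trig)
  then have "S * (p * (1 + (sin X)\<^sup>2)) = S * (2 * rho \<eta> X X * sin X - X * (cos X)\<^sup>2)"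
    unfolding wp by (simp add: algebra_simps)
  then show "p * (1 + (sin X)\<^sup>2) = 2 * rho \<eta> X X * sin X - X * (cos X)\<^sup>2"
    using S(1) by (simp only: mult_cancel_left) simp
  have "2 / g * (w * sqrt (2 * E - 2 * g * \<bar>cos X\<bar> - w\<^sup>2)) + pi = 0"
    using corner unfolding corner_condition_def Let_def w_def[symmetric] by (simp add: a trig)
  moreover have "rho \<eta> X (- p) = rho \<eta> X p"
    by (simp add: rho_def)
  ultimately have "2 / g * (S * (- p) * (S * rho \<eta> X p)) + pi = 0"
    unfolding wp r by simp
  then have "2 / g * (S\<^sup>2 * (p * rho \<eta> X p)) = pi"
    by (simp add: power2_eq_square algebra_simps)
  then show "p * rho \<eta> X p = pi * \<eta> / 4"
    unfolding S(2) using \<open>0 < g\<close> \<open>0 < E\<close> by (simp add: \<eta>_def field_simps)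
qed (use assms in auto)

theorem theorem1p2:
  fixes g c1 c2 :: real and k :: "real \<Rightarrow> real"
  assumes "g > 0"
    and "c1 > 0"
    and "\<forall>\<^sub>F E in at_top. c1 \<le> k E \<and> k E \<le> c2"
    and "\<forall>\<^sub>F E in at_top. corner_condition g E (k E)"
  shows "\<forall>\<^sub>F E in at_top. \<exists>\<phi>.
    homeomorphic_map (top_of_set (coin_invariant_set g E (k E))) coin_sequence_topology \<phi> \<and>
    (\<forall>w \<in> coin_invariant_set g E (k E). \<phi> (coin_map g E w) = shift (\<phi> w))"
proof -
  have "\<forall>\<^sub>F E in at_top. 1 \<le> E \<and> 100 * g \<le> E \<and> 100 * c2 \<le> E \<and> 100 * c2\<^sup>2 / g \<le> E"
    by (intro eventually_conj eventually_ge_at_top)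
  with assms(3,4) show ?thesis
  proof eventually_elim
    case (elim E)
    have k: "0 < k E" "(k E)\<^sup>2 \<le> c2\<^sup>2"
      using elim \<open>c1 > 0\<close> by (auto intro: power_mono)
    have "100 * c2\<^sup>2 \<le> E * g"
      using elim \<open>g > 0\<close> by (simp add: pos_divide_le_eq)
    then have "100 * (k E)\<^sup>2 \<le> E * g"
      using k(2) by linarith
    then have "100 * (k E)\<^sup>2 / E\<^sup>2 \<le> E * g / E\<^sup>2"
      by (intro divide_right_mono) auto
    then have "(k E / E)\<^sup>2 \<le> g / E / 100"
      using elim by (simp add: power_divide power2_eq_square)
    moreover have "k E / E \<le> 1 / 100" "g / E \<le> 1 / 100"
      using elim by (simp_all add: pos_divide_le_eq)
    ultimately interpret coin_billiard "g / E" "k E / E"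
        "- theta_dot_plus g E (corner_point E (k E)) / sqrt (2 * E)" g E "k E"
      using elim k \<open>g > 0\<close> by (intro coin_billiard_of_corner_condition) auto
    show ?case
      by (rule coin_map_conjugate_to_shift)
  qed
qed

end
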